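(* Let $R$ be a commutative ring and let $f\colon T\to T'$ be a proper map between two trees. The following diagram of functors is commutative up to natural equivalence: $$\begin{array}{ccc}\mathbf M^b_R(T)&\overset{\mathbb F^f}{\longrightarrow}&\mathbf M^b_R(T')\\ \downarrow&&\downarrow\\ \mathbf{mod}(\mathbf M_R(T))&\overset{\mathbb F^f_*}{\longrightarrow}&\mathbf{mod}(\mathbf M_R(T'))\end{array}$$ where the vertical functors are $R\langle A\rangle_\alpha\mapsto\operatorname{Hom}_{\mathbf M^b_R(-)}(-,R\langle A\rangle_\alpha)$ restricted to non-big objects.
   Context: A tree is a contractible, locally compact $1$-dimensional CW-complex; all trees are non-compact. $\mathfrak F(T)=\lim_K\pi_0(T-K)$ ($K\subset T$ compact) is the space of Freudenthal ends and $\hat T=T\sqcup\mathfrak F(T)$ the Freudenthal compactification, in which basic neighbourhoods of an end are $W\sqcup W^{\mathfrak F}$ with $W$ the component of some $T-K$ determined by the end and $W^{\mathfrak F}$ the set of ends determining $W$. A possibly big free $T$-controlled $R$-module $R\langle A\rangle_\alpha$ is the free $R$-module with basis a discrete set $A$ together with a function $\alpha\colon A\to T$; it is a (non-big) free $T$-controlled $R$-module if $\alpha$ is proper. A controlled homomorphism $\varphi\colon R\langle A\rangle_\alpha\to R\langle B\rangle_\beta$ is an $R$-homomorphism $R\langle A\rangle\to R\langle B\rangle$ such that for every neighbourhood $U$ of an end $\varepsilon\in\mathfrak F(T)$ in $\hat T$ there is another neighbourhood $V\subset U$ of $\varepsilon$ with $\varphi(\alpha^{-1}(V))\subset R\langle\beta^{-1}(U)\rangle$.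 $\mathbf M^b_R(T)$ is the category of possibly big free $T$-controlled $R$-modules and controlled homomorphisms, and $\mathbf M_R(T)$ the full subcategory of non-big ones. For a small additive category $\mathbf A$, $\mathbf{mod}(\mathbf A)$ is the category of additive functors $\mathbf A^{op}\to\mathbf{Ab}$. The ``change of tree'' functor $\mathbb F^f$ is $R\langle A\rangle_\alpha\mapsto R\langle A\rangle_{f\alpha}$, the identity on underlying homomorphisms; it restricts to $\mathbf M_R(T)\to\mathbf M_R(T')$. The functor $\mathbb F^f_*\colon\mathbf{mod}(\mathbf M_R(T))\to\mathbf{mod}(\mathbf M_R(T'))$ is the left adjoint of the functor given by precomposition with $\mathbb F^f\colon\mathbf M_R(T)\to\mathbf M_R(T')$. *)

theory Defs
  imports "HOL-Analysis.Analysis" "HOL-Algebra.Module" "HOL-Algebra.Weak_Morphisms"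
begin

section \<open>Categories\<close>

record ('o, 'm) cat =
  obj :: "'o set"
  arr :: "'o \<Rightarrow> 'o \<Rightarrow> 'm set"
  ident :: "'o \<Rightarrow> 'm"
  cmp :: "'o \<Rightarrow> 'o \<Rightarrow> 'o \<Rightarrow> 'm \<Rightarrow> 'm \<Rightarrow> 'm"

text \<open>
  \<open>cmp C X Y Z g f\<close> is the composite of \<open>f : X \<rightarrow> Y\<close> and \<open>g : Y \<rightarrow> Z\<close>. Different hom sets may
  overlap, hence the explicit objects here and in the action of functors on morphisms.
\<close>

locale category =
  fixes C :: "('o, 'm, 'z) cat_scheme"
  assumes ident_arr: "X \<in> obj C \<Longrightarrow> ident C X \<in> arr C X X"
    and comp_arr: "\<lbrakk>X \<in> obj C; Y \<in> obj C; Z \<in> obj C; f \<in> arr C X Y; g \<in> arr C Y Z\<rbrakk>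
      \<Longrightarrow> cmp C X Y Z g f \<in> arr C X Z"
    and comp_ident_right: "\<lbrakk>X \<in> obj C; Y \<in> obj C; f \<in> arr C X Y\<rbrakk>
      \<Longrightarrow> cmp C X X Y f (ident C X) = f"
    and comp_ident_left: "\<lbrakk>X \<in> obj C; Y \<in> obj C; f \<in> arr C X Y\<rbrakk>
      \<Longrightarrow> cmp C X Y Y (ident C Y) f = f"
    and comp_assoc: "\<lbrakk>W \<in> obj C; X \<in> obj C; Y \<in> obj C; Z \<in> obj C;
        f \<in> arr C W X; g \<in> arr C X Y; h \<in> arr C Y Z\<rbrakk>
      \<Longrightarrow> cmp C W Y Z h (cmp C W X Y g f) = cmp C W X Z (cmp C X Y Z h g) f"

definition iso_arr :: "('o, 'm, 'z) cat_scheme \<Rightarrow> 'o \<Rightarrow> 'o \<Rightarrow> 'm \<Rightarrow> bool" where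
  "iso_arr C X Y f \<longleftrightarrow> f \<in> arr C X Y \<and>
     (\<exists>g \<in> arr C Y X. cmp C X Y X g f = ident C X \<and> cmp C Y X Y f g = ident C Y)"

definition full_subcategory :: "('o, 'm, 'z) cat_scheme \<Rightarrow> 'o set \<Rightarrow> ('o, 'm, 'z) cat_scheme" where
  "full_subcategory C S = C\<lparr>obj := obj C \<inter> S\<rparr>"

record ('o, 'm, 'p, 'n) functor_data =
  fob :: "'o \<Rightarrow> 'p"
  fmor :: "'o \<Rightarrow> 'o \<Rightarrow> 'm \<Rightarrow> 'n"

definition is_functor ::
  "('o, 'm, 'y) cat_scheme \<Rightarrow> ('p, 'n, 'z) cat_scheme \<Rightarrow> ('o, 'm, 'p, 'n) functor_data \<Rightarrow> bool" where
  "is_functor C D F \<longleftrightarrow> category C \<and> category D \<and>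
     (\<forall>X \<in> obj C. fob F X \<in> obj D) \<and>
     (\<forall>X \<in> obj C. \<forall>Y \<in> obj C. \<forall>f \<in> arr C X Y. fmor F X Y f \<in> arr D (fob F X) (fob F Y)) \<and>
     (\<forall>X \<in> obj C. fmor F X X (ident C X) = ident D (fob F X)) \<and>
     (\<forall>X \<in> obj C. \<forall>Y \<in> obj C. \<forall>Z \<in> obj C. \<forall>f \<in> arr C X Y. \<forall>g \<in> arr C Y Z.
        fmor F X Z (cmp C X Y Z g f)
          = cmp D (fob F X) (fob F Y) (fob F Z) (fmor F Y Z g) (fmor F X Y f))"

definition functor_comp ::
  "('p, 'n, 'q, 'l) functor_data \<Rightarrow> ('o, 'm, 'p, 'n) functor_data \<Rightarrow> ('o, 'm, 'q, 'l) functor_data"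
  where
  "functor_comp G F = \<lparr>fob = (\<lambda>X. fob G (fob F X)),
     fmor = (\<lambda>X Y f. fmor G (fob F X) (fob F Y) (fmor F X Y f))\<rparr>"

definition is_nat_trans ::
  "('o, 'm, 'y) cat_scheme \<Rightarrow> ('p, 'n, 'z) cat_scheme \<Rightarrow> ('o, 'm, 'p, 'n) functor_data
    \<Rightarrow> ('o, 'm, 'p, 'n) functor_data \<Rightarrow> ('o \<Rightarrow> 'n) \<Rightarrow> bool" where
  "is_nat_trans C D F G \<eta> \<longleftrightarrow> is_functor C D F \<and> is_functor C D G \<and>
     \<eta> \<in> (\<Pi>\<^sub>E X \<in> obj C. arr D (fob F X) (fob G X)) \<and>
     (\<forall>X \<in> obj C. \<forall>Y \<in> obj C. \<forall>f \<in> arr C X Y.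
        cmp D (fob F X) (fob F Y) (fob G Y) (\<eta> Y) (fmor F X Y f)
          = cmp D (fob F X) (fob G X) (fob G Y) (fmor G X Y f) (\<eta> X))"

definition naturally_isomorphic ::
  "('o, 'm, 'y) cat_scheme \<Rightarrow> ('p, 'n, 'z) cat_scheme \<Rightarrow> ('o, 'm, 'p, 'n) functor_data
    \<Rightarrow> ('o, 'm, 'p, 'n) functor_data \<Rightarrow> bool" where
  "naturally_isomorphic C D F G \<longleftrightarrow>
     (\<exists>\<eta>. is_nat_trans C D F G \<eta> \<and> (\<forall>X \<in> obj C. iso_arr D (fob F X) (fob G X) (\<eta> X)))"

definition functor_category ::
  "('o, 'm, 'y) cat_scheme \<Rightarrow> ('p, 'n, 'z) cat_scheme
    \<Rightarrow> (('o, 'm, 'p, 'n) functor_data, 'o \<Rightarrow> 'n) cat" where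
  "functor_category C D =
    \<lparr>obj = {F. is_functor C D F},
     arr = (\<lambda>F G. {\<eta>. is_nat_trans C D F G \<eta>}),
     ident = (\<lambda>F. \<lambda>X \<in> obj C. ident D (fob F X)),
     cmp = (\<lambda>F G H \<theta> \<eta>. \<lambda>X \<in> obj C. cmp D (fob F X) (fob G X) (fob H X) (\<theta> X) (\<eta> X))\<rparr>"

definition is_left_adjoint ::
  "('o, 'm, 'y) cat_scheme \<Rightarrow> ('p, 'n, 'z) cat_scheme \<Rightarrow> ('o, 'm, 'p, 'n) functor_data
    \<Rightarrow> ('p, 'n, 'o, 'm) functor_data \<Rightarrow> bool" where
  "is_left_adjoint C D L U \<longleftrightarrow> is_functor C D L \<and> is_functor D C U \<and>
    (\<exists>\<Phi>.
      (\<forall>X \<in> obj C. \<forall>Y \<in> obj D. bij_betw (\<Phi> X Y) (arr D (fob L X) Y) (arr C X (fob U Y))) \<and>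
      (\<forall>X' \<in> obj C. \<forall>X \<in> obj C. \<forall>Y \<in> obj D. \<forall>f \<in> arr C X' X. \<forall>h \<in> arr D (fob L X) Y.
         \<Phi> X' Y (cmp D (fob L X') (fob L X) Y h (fmor L X' X f))
           = cmp C X' X (fob U Y) (\<Phi> X Y h) f) \<and>
      (\<forall>X \<in> obj C. \<forall>Y \<in> obj D. \<forall>Y' \<in> obj D. \<forall>k \<in> arr D Y Y'. \<forall>h \<in> arr D (fob L X) Y.
         \<Phi> X Y' (cmp D (fob L X) Y Y' k h)
           = cmp C X (fob U Y) (fob U Y') (fmor U Y Y' k) (\<Phi> X Y h)))"


section \<open>Additive functors and modules over a category\<close>

record ('o, 'm) ab_cat = "('o, 'm) cat" +
  hadd :: "'o \<Rightarrow> 'o \<Rightarrow> 'm \<Rightarrow> 'm \<Rightarrow> 'm"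
  hzero :: "'o \<Rightarrow> 'o \<Rightarrow> 'm"

definition hom_group :: "('o, 'm, 'z) ab_cat_scheme \<Rightarrow> 'o \<Rightarrow> 'o \<Rightarrow> 'm monoid" where
  "hom_group C X Y = \<lparr>carrier = arr C X Y, mult = hadd C X Y, one = hzero C X Y\<rparr>"

definition is_additive_functor ::
  "('o, 'm, 'y) ab_cat_scheme \<Rightarrow> ('p, 'n, 'z) ab_cat_scheme \<Rightarrow> ('o, 'm, 'p, 'n) functor_data \<Rightarrow> bool"
  where
  "is_additive_functor C D F \<longleftrightarrow> is_functor C D F \<and>
     (\<forall>X \<in> obj C. \<forall>Y \<in> obj C. fmor F X Y \<in> hom (hom_group C X Y) (hom_group D (fob F X) (fob F Y)))"

definition op_cat :: "('o, 'm) ab_cat \<Rightarrow> ('o, 'm) ab_cat" where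
  "op_cat C =
    \<lparr>obj = obj C,
     arr = (\<lambda>X Y. arr C Y X),
     ident = ident C,
     cmp = (\<lambda>X Y Z g f. cmp C Z Y X f g),
     hadd = (\<lambda>X Y. hadd C Y X),
     hzero = (\<lambda>X Y. hzero C Y X)\<rparr>"

definition op_functor :: "('o, 'm, 'p, 'n) functor_data \<Rightarrow> ('o, 'm, 'p, 'n) functor_data" where
  "op_functor F = \<lparr>fob = fob F, fmor = (\<lambda>X Y. fmor F Y X)\<rparr>"

text \<open>
  The category of abelian groups whose elements lie in the type \<open>'g\<close>. The group operation is
  written multiplicatively, as usual in HOL-Algebra; homomorphisms are made extensional so that
  equality of morphisms is equality of functions.
\<close>

definition Ab_cat :: "('g monoid, 'g \<Rightarrow> 'g) ab_cat" where
  "Ab_cat =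
    \<lparr>obj = {G. comm_group G},
     arr = (\<lambda>G H. hom G H \<inter> extensional (carrier G)),
     ident = (\<lambda>G. \<lambda>x \<in> carrier G. x),
     cmp = (\<lambda>G H K g f. compose (carrier G) g f),
     hadd = (\<lambda>G H u v. \<lambda>x \<in> carrier G. u x \<otimes>\<^bsub>H\<^esub> v x),
     hzero = (\<lambda>G H. \<lambda>x \<in> carrier G. \<one>\<^bsub>H\<^esub>)\<rparr>"

type_synonym ('o, 'm, 'g) cat_module = "('o, 'm, 'g monoid, 'g \<Rightarrow> 'g) functor_data"

definition mod_cat :: "('o, 'm) ab_cat \<Rightarrow> (('o, 'm, 'g) cat_module, 'o \<Rightarrow> 'g \<Rightarrow> 'g) cat" where
  "mod_cat A = full_subcategory (functor_category (op_cat A) Ab_cat)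
     {M. is_additive_functor (op_cat A) Ab_cat M}"

text \<open>Precomposition with \<open>F : A \<rightarrow> B\<close>, as a functor from \<open>mod_cat B\<close> to \<open>mod_cat A\<close>.\<close>

definition precomposition ::
  "('o, 'm) ab_cat \<Rightarrow> ('o, 'm, 'p, 'n) functor_data
    \<Rightarrow> (('p, 'n, 'g) cat_module, 'p \<Rightarrow> 'g \<Rightarrow> 'g, ('o, 'm, 'g) cat_module, 'o \<Rightarrow> 'g \<Rightarrow> 'g) functor_data"
  where
  "precomposition A F =
    \<lparr>fob = (\<lambda>N. functor_comp N (op_functor F)),
     fmor = (\<lambda>N N' \<eta>. \<lambda>X \<in> obj A. \<eta> (fob F X))\<rparr>"

text \<open>
  Contravariant hom functors. As all values of an object of \<^const>\<open>mod_cat\<close> have their elements in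
  one type \<open>'g\<close>, the hom groups are transported to \<open>'g\<close> along an injection \<open>j\<close>; any type into
  which the morphisms embed can be used, with \<open>j = id\<close> when \<open>'g\<close> is the type of morphisms itself.
\<close>

definition hom_functor ::
  "('m \<Rightarrow> 'g) \<Rightarrow> ('o, 'm) ab_cat \<Rightarrow> 'o \<Rightarrow> ('o, 'm, 'g) cat_module" where
  "hom_functor j C Y =
    \<lparr>fob = (\<lambda>X. image_group j (hom_group C X Y)),
     fmor = (\<lambda>X X' f. \<lambda>u \<in> j ` arr C X Y. j (cmp C X' X Y (inv_into (arr C X Y) j u) f))\<rparr>"

text \<open>
  The functor \<open>Y \<mapsto> Hom\<^sub>C(-, Y)\<close> restricted to a full subcategory \<open>A\<close> of \<open>C\<close>, with values in
  \<open>mod_cat A\<close>. On objects nothing needs to be restricted: the objects outside \<open>A\<close> are irrelevant.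
\<close>

definition restricted_yoneda ::
  "('m \<Rightarrow> 'g) \<Rightarrow> ('o, 'm) ab_cat \<Rightarrow> ('o, 'm) ab_cat
    \<Rightarrow> ('o, 'm, ('o, 'm, 'g) cat_module, 'o \<Rightarrow> 'g \<Rightarrow> 'g) functor_data" where
  "restricted_yoneda j C A =
    \<lparr>fob = hom_functor j C,
     fmor = (\<lambda>Y Y' h. \<lambda>X \<in> obj A. \<lambda>u \<in> j ` arr C X Y. j (cmp C X Y Y' h (inv_into (arr C X Y) j u)))\<rparr>"


section \<open>Trees and their Freudenthal compactification\<close>

text \<open>
  \<open>V\<close> is the set of vertices and \<open>\<Phi>\<close> the set of characteristic maps \<open>[0, 1] \<rightarrow> X\<close> of the 1-cells;
  the last clause is the weak topology; it makes every subset of \<open>V\<close> closed.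
\<close>

definition one_dimensional_CW_complex :: "'t topology \<Rightarrow> bool" where
  "one_dimensional_CW_complex X \<longleftrightarrow> Hausdorff_space X \<and>
    (\<exists>V (\<Phi> :: (real \<Rightarrow> 't) set). \<Phi> \<noteq> {} \<and>
      (\<forall>\<phi> \<in> \<Phi>. continuous_map (top_of_set {0..1}) X \<phi> \<and> \<phi> 0 \<in> V \<and> \<phi> 1 \<in> V \<and>
         inj_on \<phi> {0<..<1} \<and> disjnt (\<phi> ` {0<..<1}) V) \<and>
      (\<forall>\<phi> \<in> \<Phi>. \<forall>\<psi> \<in> \<Phi>. \<phi> \<noteq> \<psi> \<longrightarrow> disjnt (\<phi> ` {0<..<1}) (\<psi> ` {0<..<1})) \<and>
      topspace X = V \<union> (\<Union>\<phi> \<in> \<Phi>. \<phi> ` {0<..<1}) \<and>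
      (\<forall>S. S \<subseteq> topspace X \<longrightarrow>
         (closedin X S \<longleftrightarrow> (\<forall>\<phi> \<in> \<Phi>. closedin (top_of_set {0..1}) {t \<in> {0..1}. \<phi> t \<in> S}))))"

definition is_tree :: "'t topology \<Rightarrow> bool" where
  "is_tree T \<longleftrightarrow> one_dimensional_CW_complex T \<and> contractible_space T \<and>
     locally_compact_space T \<and> \<not> compact_space T"

definition complement_components :: "'t topology \<Rightarrow> 't set \<Rightarrow> 't set set" where
  "complement_components T K = path_components_of (subtopology T (topspace T - K))"

text \<open>The inverse limit of the sets of path components of \<open>T - K\<close>, for \<open>K\<close> compact.\<close>

definition freudenthal_ends :: "'t topology \<Rightarrow> ('t set \<Rightarrow> 't set) set" where
  "freudenthal_ends T =
    {\<epsilon> \<in> \<Pi>\<^sub>E K \<in> {K. compactin T K}. complement_components T K.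
       \<forall>K L. compactin T K \<and> compactin T L \<and> K \<subseteq> L \<longrightarrow> \<epsilon> L \<subseteq> \<epsilon> K}"

definition end_nbhd :: "'t topology \<Rightarrow> 't set \<Rightarrow> 't set \<Rightarrow> ('t + ('t set \<Rightarrow> 't set)) set" where
  "end_nbhd T K W = Inl ` W \<union> Inr ` {\<epsilon> \<in> freudenthal_ends T. \<epsilon> K = W}"

definition freudenthal_compactification ::
  "'t topology \<Rightarrow> ('t + ('t set \<Rightarrow> 't set)) topology" where
  "freudenthal_compactification T = topology_generated_by
    ({Inl ` U | U. openin T U} \<union>
     {end_nbhd T K W | K W. compactin T K \<and> W \<in> complement_components T K})"

definition nbhd_in :: "'x topology \<Rightarrow> 'x \<Rightarrow> 'x set \<Rightarrow> bool" where
  "nbhd_in X x U \<longleftrightarrow> U \<subseteq> topspace X \<and> (\<exists>W. openin X W \<and> x \<in> W \<and> W \<subseteq> U)"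


section \<open>Free controlled modules\<close>

text \<open>
  Elements of the free module on \<open>A\<close> are finitely supported functions vanishing (rather than
  undefined) off \<open>A\<close>, so that the free module on a subset of \<open>A\<close> is literally a submodule. The
  fields \<open>mult\<close> and \<open>one\<close> play no role in a module.
\<close>

definition free_module :: "('r, 'x) ring_scheme \<Rightarrow> 'a set \<Rightarrow> ('r, 'a \<Rightarrow> 'r) module" where
  "free_module R A =
    \<lparr>carrier = {x. (\<forall>a. x a \<in> carrier R) \<and> finite {a. x a \<noteq> \<zero>\<^bsub>R\<^esub>} \<and> {a. x a \<noteq> \<zero>\<^bsub>R\<^esub>} \<subseteq> A},
     mult = undefined, one = undefined,
     zero = (\<lambda>a. \<zero>\<^bsub>R\<^esub>),
     add = (\<lambda>x y a. x a \<oplus>\<^bsub>R\<^esub> y a),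
     smult = (\<lambda>r x a. r \<otimes>\<^bsub>R\<^esub> x a)\<rparr>"

definition basis_elt :: "('r, 'x) ring_scheme \<Rightarrow> 'a \<Rightarrow> 'a \<Rightarrow> 'r" where
  "basis_elt R a = (\<lambda>b. if b = a then \<one>\<^bsub>R\<^esub> else \<zero>\<^bsub>R\<^esub>)"

definition module_homs ::
  "('r, 'x) ring_scheme \<Rightarrow> ('r, 'p, 'y) module_scheme \<Rightarrow> ('r, 'q, 'z) module_scheme \<Rightarrow> ('p \<Rightarrow> 'q) set"
  where
  "module_homs R M N = {\<phi> \<in> carrier M \<rightarrow>\<^sub>E carrier N.
     (\<forall>x \<in> carrier M. \<forall>y \<in> carrier M. \<phi> (x \<oplus>\<^bsub>M\<^esub> y) = \<phi> x \<oplus>\<^bsub>N\<^esub> \<phi> y) \<and>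
     (\<forall>r \<in> carrier R. \<forall>x \<in> carrier M. \<phi> (r \<odot>\<^bsub>M\<^esub> x) = r \<odot>\<^bsub>N\<^esub> \<phi> x)}"

text \<open>The pair \<open>(A, \<alpha>)\<close> stands for the controlled module with basis \<open>A\<close> and control map \<open>\<alpha>\<close>.\<close>

type_synonym ('a, 't) controlled = "'a set \<times> ('a \<Rightarrow> 't)"

definition is_controlled ::
  "('r, 'x) ring_scheme \<Rightarrow> 't topology \<Rightarrow> ('a, 't) controlled \<Rightarrow> ('a, 't) controlled
    \<Rightarrow> (('a \<Rightarrow> 'r) \<Rightarrow> ('a \<Rightarrow> 'r)) \<Rightarrow> bool" where
  "is_controlled R T = (\<lambda>(A, \<alpha>) (B, \<beta>) \<phi>.
     \<forall>\<epsilon> \<in> freudenthal_ends T. \<forall>U. nbhd_in (freudenthal_compactification T) (Inr \<epsilon>) U \<longrightarrow>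
       (\<exists>V \<subseteq> U. nbhd_in (freudenthal_compactification T) (Inr \<epsilon>) V \<and>
         (\<forall>a \<in> A. Inl (\<alpha> a) \<in> V \<longrightarrow>
            \<phi> (basis_elt R a) \<in> carrier (free_module R {b \<in> B. Inl (\<beta> b) \<in> U}))))"

definition big_controlled_cat ::
  "('r, 'x) ring_scheme \<Rightarrow> 't topology
    \<Rightarrow> (('a, 't) controlled, ('a \<Rightarrow> 'r) \<Rightarrow> ('a \<Rightarrow> 'r)) ab_cat" where
  "big_controlled_cat R T =
    \<lparr>obj = {(A, \<alpha>). \<alpha> \<in> A \<rightarrow>\<^sub>E topspace T},
     arr = (\<lambda>X Y. {\<phi> \<in> module_homs R (free_module R (fst X)) (free_module R (fst Y)).
        is_controlled R T X Y \<phi>}),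
     ident = (\<lambda>X. \<lambda>x \<in> carrier (free_module R (fst X)). x),
     cmp = (\<lambda>X Y Z \<psi> \<phi>. compose (carrier (free_module R (fst X))) \<psi> \<phi>),
     hadd = (\<lambda>X Y \<phi> \<psi>. \<lambda>x \<in> carrier (free_module R (fst X)). \<phi> x \<oplus>\<^bsub>free_module R (fst Y)\<^esub> \<psi> x),
     hzero = (\<lambda>X Y. \<lambda>x \<in> carrier (free_module R (fst X)). \<zero>\<^bsub>free_module R (fst Y)\<^esub>)\<rparr>"

definition controlled_cat ::
  "('r, 'x) ring_scheme \<Rightarrow> 't topology
    \<Rightarrow> (('a, 't) controlled, ('a \<Rightarrow> 'r) \<Rightarrow> ('a \<Rightarrow> 'r)) ab_cat" where
  "controlled_cat R T = full_subcategory (big_controlled_cat R T)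
     {(A, \<alpha>). proper_map (discrete_topology A) T \<alpha>}"

definition change_of_tree ::
  "('t \<Rightarrow> 'u) \<Rightarrow> (('a, 't) controlled, 'm, ('a, 'u) controlled, 'm) functor_data" where
  "change_of_tree f =
    \<lparr>fob = (\<lambda>(A, \<alpha>). (A, compose A f \<alpha>)), fmor = (\<lambda>X Y \<phi>. \<phi>)\<rparr>"

end

theory Submission
  imports Defs
begin

text \<open>
  As \<open>F\<^sub>*\<close> is a left adjoint of restriction along \<open>F\<close>, it is enough to see that
  \<open>Hom(-, F X)\<close> on the non-big modules over \<open>T'\<close> is the universal module receiving a map from
  \<open>Hom(-, X)\<close>: every natural transformation from \<open>Hom(-, X)\<close> to the restriction of a module \<open>N\<close>
  over \<open>T'\<close> factors through a unique \<open>Hom(-, F X) \<rightarrow> N\<close> (\<open>comparison_universal\<close>). The formal passage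
  from this to a natural isomorphism is \<open>left_adjoint_naturally_isomorphic\<close>. The comparison map
  \<open>Hom(Z, X) \<rightarrow> Hom(F Z, F X)\<close> is literally an inclusion of sets, since \<open>F\<close> does not change the
  underlying homomorphisms.

  The universal property holds because, over either tree, \<open>Hom(-, X)\<close> is a directed union of
  representable functors. Let \<open>X\<close> have basis \<open>A\<close> and control map \<open>\<alpha>\<close>. A morphism from a non-big
  module to \<open>X\<close> involves only the basis elements in some \<open>B \<subseteq> A\<close> on which \<open>\<alpha>\<close> is still proper
  (\<open>subobject_hom_support_obj\<close>), so it factors through the non-big subobject spanned by \<open>B\<close>. Because \<open>f\<close> is
  continuous and proper, \<open>\<alpha>\<close> is proper on \<open>B\<close> if and only if \<open>f \<circ> \<alpha>\<close> is (\<open>F_obj_iff\<close>). Hence the two unions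
  have the same index set, and by the Yoneda lemma both kinds of natural transformation
  amount to the same thing: a compatible family of elements of \<open>N\<close> at the modules with basis
  \<open>B\<close> and control map \<open>f \<circ> \<alpha>\<close>.

  The geometry of trees enters twice: in the properness of \<open>\<alpha>\<close> on such a \<open>B\<close>
  (\<open>proper_controlled_hom_image_proper\<close>), and in the fact that a homomorphism controlled over \<open>T\<close> is
  controlled over \<open>T'\<close> as well (\<open>is_controlled_change_of_tree\<close>). Both rest on the compactness of the
  Freudenthal compactification, in the form that a filter leaving every compact set
  accumulates at some end (\<open>filter_leaving_compacts_accumulates_at_end\<close>).
\<close>

section \<open>Ends of trees and control\<close>

text \<open>
  A CW complex of dimension one is locally path connected. By the weak topology, openness can be
  tested on the 1-cells, where a point mapped into the path component \<open>W\<close> has a neighbourhood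
  in \<open>[0, 1]\<close> that is an interval mapped into \<open>U\<close>, and therefore into \<open>W\<close>.
\<close>

lemma path_components_of_open_subset_open:
  assumes "one_dimensional_CW_complex X" "openin X U"
    and W: "W \<in> path_components_of (subtopology X U)"
  shows "openin X W"
proof -
  obtain V and \<Phi> :: "(real \<Rightarrow> 'a) set"
    where cont: "\<And>\<phi>. \<phi> \<in> \<Phi> \<Longrightarrow> continuous_map (top_of_set {0..1}) X \<phi>"
      and weak: "\<And>S. S \<subseteq> topspace X \<Longrightarrow>
         closedin X S \<longleftrightarrow> (\<forall>\<phi> \<in> \<Phi>. closedin (top_of_set {0..1}) {t \<in> {0..1}. \<phi> t \<in> S})"
    using assms(1) unfolding one_dimensional_CW_complex_def by (elim conjE exE) blast
  have WU: "W \<subseteq> U" "W \<subseteq> topspace X"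
    using path_components_of_subset[OF W] by auto
  have op: "openin (top_of_set {0..1}) {t \<in> {0..1}. \<phi> t \<in> W}" if "\<phi> \<in> \<Phi>" for \<phi>
    unfolding openin_euclidean_subtopology_iff
  proof (intro conjI ballI)
    fix t assume t: "t \<in> {t \<in> {0..1}. \<phi> t \<in> W}"
    have "openin (top_of_set {0..1}) {t \<in> {0..1}. \<phi> t \<in> U}"
      using openin_continuous_map_preimage[OF cont[OF that] assms(2)] by simp
    then obtain e where e: "e > 0" "\<And>s. s \<in> {0..1} \<Longrightarrow> dist s t < e \<Longrightarrow> \<phi> s \<in> U"
      unfolding openin_euclidean_subtopology_iff using t WU by blast
    let ?J = "{0..1} \<inter> ball t e"
    have "path_connected ?J"
      by (intro convex_imp_path_connected convex_Int) auto
    then have "path_connectedin (top_of_set {0..1}) ?J"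
      by (simp add: path_connectedin_subtopology path_connectedin_iff_path_connected_real)
    then have "path_connectedin X (\<phi> ` ?J)"
      by (rule path_connectedin_continuous_map_image[OF cont[OF that]])
    then have "path_connectedin (subtopology X U) (\<phi> ` ?J)"
      using e by (auto simp: path_connectedin_subtopology dist_commute)
    moreover have "\<phi> t \<in> W \<inter> \<phi> ` ?J"
      using t e(1) by auto
    ultimately have "\<phi> ` ?J \<subseteq> W"
      using path_components_of_maximal[OF W] unfolding disjnt_def by blast
    then show "\<exists>e>0. \<forall>s\<in>{0..1}. dist s t < e \<longrightarrow> s \<in> {t \<in> {0..1}. \<phi> t \<in> W}"
      using e(1) by (auto simp: dist_commute intro!: exI[of _ e])
  qed auto
  then have "closedin (top_of_set {0..1}) {t \<in> {0..1}. \<phi> t \<in> topspace X - W}" if "\<phi> \<in> \<Phi>" for \<phi>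
  proof -
    have "{t \<in> {0..1}. \<phi> t \<in> topspace X - W} = {0..1} - {t \<in> {0..1}. \<phi> t \<in> W}"
      using cont[OF that] by (auto simp: continuous_map_def Pi_iff)
    moreover have "closedin (top_of_set {0..1::real}) ({0..1} - {t \<in> {0..1}. \<phi> t \<in> W})"
      using closedin_diff[OF closedin_topspace op[OF that]] by simp
    ultimately show ?thesis by simp
  qed
  then have "closedin X (topspace X - W)"
    by (simp add: weak)
  then show ?thesis
    using WU openin_closedin_eq by blast
qed

lemma is_treeD:
  assumes "is_tree T"
  shows "Hausdorff_space T" "connected_space T" "locally_compact_space T"
    "one_dimensional_CW_complex T"
proof -
  have T: "one_dimensional_CW_complex T" "contractible_space T" "locally_compact_space T"
    using assms unfolding is_tree_def by auto
  show "Hausdorff_space T"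
    using T(1) unfolding one_dimensional_CW_complex_def by (rule conjunct1)
  show "connected_space T"
    by (rule path_connected_imp_connected_space[OF contractible_imp_path_connected_space[OF T(2)]])
qed (use assms in \<open>simp_all add: is_tree_def\<close>)

lemma compactin_imp_openin_complement:
  "Hausdorff_space T \<Longrightarrow> compactin T K \<Longrightarrow> openin T (topspace T - K)"
  by (simp add: compactin_imp_closedin openin_diff)

lemma complement_componentsD:
  assumes "W \<in> complement_components T K"
  shows "W \<subseteq> topspace T - K" "W \<noteq> {}" "path_connectedin T W"
  using path_components_of_subset[of W "subtopology T (topspace T - K)"]
    nonempty_path_components_of[of W "subtopology T (topspace T - K)"]
    path_connectedin_path_components_of[of W "subtopology T (topspace T - K)"] assms
  unfolding complement_components_def by (auto simp: path_connectedin_subtopology)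

lemma Union_complement_components:
  "\<Union>(complement_components T K) = topspace T - K"
  unfolding complement_components_def by (auto simp: Union_path_components_of)

lemma complement_components_maximal:
  assumes "W \<in> complement_components T K" "path_connectedin T S" "S \<inter> K = {}" "W \<inter> S \<noteq> {}"
  shows "S \<subseteq> W"
proof -
  have "path_connectedin (subtopology T (topspace T - K)) S"
    using assms(2,3) path_connectedin_subset_topspace[OF assms(2)]
    by (auto simp: path_connectedin_subtopology)
  then show ?thesis
    using path_components_of_maximal assms(1,4)
    unfolding complement_components_def disjnt_def by blast
qed

lemma complement_components_eq:
  assumes "W \<in> complement_components T K" "W' \<in> complement_components T K" "W \<inter> W' \<noteq> {}"
  shows "W = W'"
  using assms path_components_of_overlap[of W "subtopology T (topspace T - K)" W']
  unfolding complement_components_def by simp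

lemma complement_components_open:
  assumes "is_tree T" "compactin T K" "W \<in> complement_components T K"
  shows "openin T W"
  using path_components_of_open_subset_open[OF is_treeD(4)[OF assms(1)]
      compactin_imp_openin_complement[OF is_treeD(1)[OF assms(1)] assms(2)]] assms(3)
  unfolding complement_components_def .

text \<open>
  For \<open>K\<close> with a wild boundary, \<open>T - K\<close> can have infinitely many components, but only finitely
  many of them leave a compact neighbourhood \<open>L\<close> of \<open>K\<close>. If \<open>U\<close> is open with
  \<open>K \<subseteq> U \<subseteq> L\<close>, then the compact set \<open>L - U\<close> is covered by finitely many of the open components. A
  component that misses \<open>L - U\<close> and is not contained in \<open>L\<close> misses \<open>U\<close>, so that it is open and
  closed in the connected space \<open>T\<close> and equal to it.
\<close>

lemma finite_complement_components_outside_compact: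
  assumes T: "is_tree T" and K: "compactin T K"
  obtains L where "compactin T L" "finite {W \<in> complement_components T K. \<not> W \<subseteq> L}"
proof -
  note TD = is_treeD[OF T]
  obtain U L where UL: "openin T U" "compactin T L" "closedin T L" "K \<subseteq> U" "U \<subseteq> L"
    using TD(1,3) K locally_compact_space_compact_closed_compact by metis
  have LU: "compactin T (L - U)"
    using UL by (metis closedin_diff closed_compactin Diff_subset openin_closedin_eq
        closedin_def closedin_topspace openin_subset double_diff)
  have opn: "openin T W" if "W \<in> complement_components T K" for W
    using complement_components_open[OF T K that] .
  have "L - U \<subseteq> \<Union>(complement_components T K)"
    using UL closedin_subset by (fastforce simp: Union_complement_components)
  then obtain \<W> where \<W>: "finite \<W>" "\<W> \<subseteq> complement_components T K" "L - U \<subseteq> \<Union>\<W>"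
    using compactinD[OF LU, of "complement_components T K"] opn by auto
  have "W \<in> insert (topspace T) \<W>" if W: "W \<in> complement_components T K" "\<not> W \<subseteq> L" for W
  proof (cases "W \<inter> (L - U) = {}")
    case False
    then obtain W' where "W' \<in> \<W>" "W \<inter> W' \<noteq> {}"
      using \<W>(3) by blast
    then show ?thesis
      using complement_components_eq W(1) \<W>(2) by (metis insertCI subsetD)
  next
    case True
    have "connectedin T W"
      using complement_componentsD(3)[OF W(1)] by (rule path_connectedin_imp_connectedin)
    moreover have "openin T (topspace T - L)" "W \<subseteq> U \<union> (topspace T - L)"
      using UL(3) True complement_componentsD(1)[OF W(1)] by auto
    moreover have "U \<inter> (topspace T - L) \<inter> W = {}"
      using UL(5) by blast
    ultimately have "U \<inter> W = {} \<or> (topspace T - L) \<inter> W = {}"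
      using UL(1) unfolding connectedin by metis
    then have "W \<inter> U = {}"
      using W(2) complement_componentsD(1)[OF W(1)] by blast
    moreover have "topspace T - W = U \<union> \<Union>(complement_components T K - {W})"
      using calculation UL(4) openin_subset[OF UL(1)]
        complement_path_components_of_Union[OF W(1)[unfolded complement_components_def]]
      unfolding complement_components_def by auto
    then have "openin T (topspace T - W)"
      using UL(1) opn by (auto intro!: openin_Un openin_Union)
    then have "closedin T W"
      using complement_componentsD(1)[OF W(1)] by (auto simp: closedin_def)
    then have "W = topspace T"
      using TD(2) opn[OF W(1)] complement_componentsD(2)[OF W(1)]
      unfolding connected_space_clopen_in by blast
    then show ?thesis by simp
  qed
  then have "finite {W \<in> complement_components T K. \<not> W \<subseteq> L}"
    using \<W>(1) by (metis (no_types, lifting) finite_insert finite_subset mem_Collect_eq subsetI)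
  then show thesis using that UL(2) by blast
qed

lemma compact_UNIV_bool_fun: "compact (UNIV :: ('a \<Rightarrow> bool) set)"
proof -
  have "compact_space (euclidean :: bool topology)"
    by (simp add: compact_space_def finite_imp_compactin finite_imp_compact)
  then have "compact_space (product_topology (\<lambda>i::'a. euclidean :: bool topology) UNIV)"
    by (simp add: compact_space_product_topology)
  then show ?thesis
    by (simp add: euclidean_product_topology compact_space_def)
qed

text \<open>
  Tychonoff's theorem for a power of \<open>bool\<close>. In the use below the coordinates are sets \<open>W\<close>, and
  the accumulation point \<open>p\<close> plays the part of an ultrafilter refining \<open>F\<close>: it decides, consistently for any
  finite number of sets, which of them contain the moving point.
\<close>

lemma filter_has_bool_accumulation:
  fixes h :: "'i \<Rightarrow> 'w \<Rightarrow> bool"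
  assumes "F \<noteq> bot"
  obtains p where "\<And>\<W>. finite \<W> \<Longrightarrow> \<exists>\<^sub>F i in F. \<forall>W \<in> \<W>. h i W = p W"
proof -
  obtain p where p: "inf (nhds p) (filtermap h F) \<noteq> bot"
    using compact_UNIV_bool_fun[unfolded compact_filter, rule_format, of "filtermap h F"] assms
    by (auto simp: filtermap_bot_iff)
  have "\<exists>\<^sub>F i in F. \<forall>W \<in> \<W>. h i W = p W" if fin: "finite \<W>" for \<W>
  proof (rule ccontr)
    have "open {q. \<forall>W \<in> \<W>. q W = p W}"
    proof -
      have "open {q :: 'w \<Rightarrow> bool. q W \<in> {p W}}" for W
        using open_vimage[OF open_discrete, of "\<lambda>q. q W" "{p W}"]
          continuous_on_product_coordinates by (simp add: vimage_def)
      then have "open {q. q W = p W}" for W by simp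
      then have "open (\<Inter>W\<in>\<W>. {q. q W = p W})"
        using fin by blast
      moreover have "(\<Inter>W\<in>\<W>. {q. q W = p W}) = {q. \<forall>W \<in> \<W>. q W = p W}" by auto
      ultimately show ?thesis by simp
    qed
    then have "eventually (\<lambda>q. \<forall>W \<in> \<W>. q W = p W) (nhds p)"
      by (auto simp: eventually_nhds)
    moreover assume "\<not> (\<exists>\<^sub>F i in F. \<forall>W \<in> \<W>. h i W = p W)"
    then have "eventually (\<lambda>q. \<not> (\<forall>W \<in> \<W>. q W = p W)) (filtermap h F)"
      by (simp add: eventually_filtermap not_frequently)
    ultimately have "eventually (\<lambda>_. False) (inf (nhds p) (filtermap h F))"
      unfolding eventually_inf by blast
    then show False using p by (simp add: trivial_limit_def)
  qed
  then show thesis by (rule that)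
qed

lemma freudenthal_endsD:
  assumes "\<epsilon> \<in> freudenthal_ends T" "compactin T K"
  shows "\<epsilon> K \<in> complement_components T K"
    and "\<And>L. compactin T L \<Longrightarrow> K \<subseteq> L \<Longrightarrow> \<epsilon> L \<subseteq> \<epsilon> K"
proof -
  have \<epsilon>: "\<epsilon> \<in> (\<Pi>\<^sub>E K \<in> {K. compactin T K}. complement_components T K)"
    "\<forall>K L. compactin T K \<and> compactin T L \<and> K \<subseteq> L \<longrightarrow> \<epsilon> L \<subseteq> \<epsilon> K"
    using assms(1) unfolding freudenthal_ends_def mem_Collect_eq by (rule conjunct1, rule conjunct2)
  show "\<epsilon> K \<in> complement_components T K"
    by (rule PiE_mem[OF \<epsilon>(1)]) (simp add: assms(2))
  show "\<epsilon> L \<subseteq> \<epsilon> K" if "compactin T L" "K \<subseteq> L" for L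
    using \<epsilon>(2) assms(2) that by simp
qed

text \<open>
  Compactness of the space of ends at infinity. For each compact \<open>K\<close>, eventually the moving point
  lies in one of finitely many components of \<open>T - K\<close>, and the accumulation point \<open>p\<close> of the
  preceding lemma selects one of them. The choices for \<open>K \<subseteq> L\<close> are compatible since the two
  selected components have a common point.
\<close>

lemma filter_leaving_compacts_accumulates_at_end:
  assumes T: "is_tree T" and F: "F \<noteq> bot"
    and leaves: "\<And>K. compactin T K \<Longrightarrow> eventually (\<lambda>i. g i \<in> topspace T - K) F"
  obtains \<epsilon> where "\<epsilon> \<in> freudenthal_ends T" "\<And>K. compactin T K \<Longrightarrow> \<exists>\<^sub>F i in F. g i \<in> \<epsilon> K"
proof -
  obtain p where p: "\<And>\<W>. finite \<W> \<Longrightarrow> \<exists>\<^sub>F i in F. \<forall>W \<in> \<W>. (g i \<in> W) = p W"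
    using filter_has_bool_accumulation[OF F, of "\<lambda>i W. g i \<in> W"] by blast
  have ex: "\<exists>W \<in> complement_components T K. p W" if K: "compactin T K" for K
  proof -
    obtain L where L: "compactin T L" "finite {W \<in> complement_components T K. \<not> W \<subseteq> L}"
      using finite_complement_components_outside_compact[OF T K] .
    have "\<exists>\<^sub>F i in F. (\<forall>W \<in> {W \<in> complement_components T K. \<not> W \<subseteq> L}. (g i \<in> W) = p W) \<and>
        g i \<in> topspace T - (K \<union> L)"
      using p[OF L(2)] leaves[OF compactin_Un[OF K L(1)]] by (rule frequently_eventually_frequently)
    then obtain i where i: "\<forall>W \<in> {W \<in> complement_components T K. \<not> W \<subseteq> L}. (g i \<in> W) = p W"
        "g i \<in> topspace T - (K \<union> L)"
      by (rule frequentlyE) blast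
    then obtain W where "W \<in> complement_components T K" "g i \<in> W"
      using Union_complement_components[of T K] by auto
    with i show ?thesis by blast
  qed
  define \<epsilon> where "\<epsilon> = (\<lambda>K \<in> {K. compactin T K}. SOME W. W \<in> complement_components T K \<and> p W)"
  have \<epsilon>: "\<epsilon> K \<in> complement_components T K" "p (\<epsilon> K)" if "compactin T K" for K
    using someI_ex[of "\<lambda>W. W \<in> complement_components T K \<and> p W"] ex[OF that] that
    unfolding \<epsilon>_def by auto
  have "\<epsilon> L \<subseteq> \<epsilon> K" if "compactin T K" "compactin T L" "K \<subseteq> L" for K L
  proof (rule complement_components_maximal[OF \<epsilon>(1)[OF that(1)]])
    show "path_connectedin T (\<epsilon> L)" "\<epsilon> L \<inter> K = {}"
      using complement_componentsD[OF \<epsilon>(1)[OF that(2)]] that(3) by auto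
    have "\<exists>\<^sub>F i in F. \<forall>W \<in> {\<epsilon> K, \<epsilon> L}. (g i \<in> W) = p W"
      by (rule p) simp
    then obtain i where "\<forall>W \<in> {\<epsilon> K, \<epsilon> L}. (g i \<in> W) = p W"
      by (rule frequentlyE)
    then show "\<epsilon> K \<inter> \<epsilon> L \<noteq> {}"
      using \<epsilon>(2) that by blast
  qed
  then have "\<epsilon> \<in> freudenthal_ends T"
    using \<epsilon>(1) unfolding freudenthal_ends_def by (auto simp: \<epsilon>_def)
  moreover have "\<exists>\<^sub>F i in F. g i \<in> \<epsilon> K" if "compactin T K" for K
    using p[of "{\<epsilon> K}"] \<epsilon>(2)[OF that] by simp
  ultimately show thesis by (rule that)
qed

text \<open>
  This makes the sets \<open>end_nbhd T K (\<epsilon> K)\<close> a downward directed family, and so a neighbourhood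
  base at \<open>\<epsilon>\<close> and not just a subbase.
\<close>

lemma end_nbhd_mono:
  assumes "\<epsilon> \<in> freudenthal_ends T" "compactin T K" "compactin T L" "K \<subseteq> L"
  shows "end_nbhd T L (\<epsilon> L) \<subseteq> end_nbhd T K (\<epsilon> K)"
proof -
  have "\<delta> K = \<epsilon> K" if \<delta>: "\<delta> \<in> freudenthal_ends T" "\<delta> L = \<epsilon> L" for \<delta>
  proof (rule complement_components_eq)
    show "\<delta> K \<in> complement_components T K" "\<epsilon> K \<in> complement_components T K"
      by (rule freudenthal_endsD(1)[OF \<delta>(1) assms(2)] freudenthal_endsD(1)[OF assms(1,2)])+
    have "\<epsilon> L \<subseteq> \<delta> K"
      using freudenthal_endsD(2)[OF \<delta>(1) assms(2-4)] unfolding \<delta>(2) .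
    then show "\<delta> K \<inter> \<epsilon> K \<noteq> {}"
      using freudenthal_endsD(2)[OF assms]
        complement_componentsD(2)[OF freudenthal_endsD(1)[OF assms(1,3)]] by blast
  qed
  then show ?thesis
    using freudenthal_endsD(2)[OF assms] unfolding end_nbhd_def by auto
qed

lemma nbhd_in_end_nbhd:
  assumes "\<epsilon> \<in> freudenthal_ends T" "compactin T K"
  shows "nbhd_in (freudenthal_compactification T) (Inr \<epsilon>) (end_nbhd T K (\<epsilon> K))"
proof -
  have "openin (freudenthal_compactification T) (end_nbhd T K (\<epsilon> K))"
    unfolding freudenthal_compactification_def openin_topology_generated_by_iff
    using freudenthal_endsD(1)[OF assms] assms(2) by (intro generate_topology_on.Basis) blast
  moreover have "Inr \<epsilon> \<in> end_nbhd T K (\<epsilon> K)"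
    using assms by (auto simp: end_nbhd_def)
  ultimately show ?thesis
    unfolding nbhd_in_def using openin_subset by blast
qed

lemma nbhd_in_contains_end_nbhd:
  assumes \<epsilon>: "\<epsilon> \<in> freudenthal_ends T"
    and "nbhd_in (freudenthal_compactification T) (Inr \<epsilon>) U"
  obtains K where "compactin T K" "end_nbhd T K (\<epsilon> K) \<subseteq> U"
proof -
  obtain W where W: "openin (freudenthal_compactification T) W" "Inr \<epsilon> \<in> W" "W \<subseteq> U"
    using assms(2) unfolding nbhd_in_def by blast
  have "\<exists>K. compactin T K \<and> end_nbhd T K (\<epsilon> K) \<subseteq> W"
    using W(1)[unfolded freudenthal_compactification_def openin_topology_generated_by_iff] W(2)
  proof (induction rule: generate_topology_on.induct)
    case (Int a b)
    then obtain K L where KL: "compactin T K" "end_nbhd T K (\<epsilon> K) \<subseteq> a"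
      "compactin T L" "end_nbhd T L (\<epsilon> L) \<subseteq> b" by blast
    have "compactin T (K \<union> L)"
      using KL by (simp add: compactin_Un)
    moreover from this have "end_nbhd T (K \<union> L) (\<epsilon> (K \<union> L)) \<subseteq> a \<inter> b"
      using KL end_nbhd_mono[OF \<epsilon>, of K "K \<union> L"] end_nbhd_mono[OF \<epsilon>, of L "K \<union> L"] by blast
    ultimately show ?case by blast
  next
    case (UN \<K>)
    then show ?case by blast
  next
    case (Basis s)
    then show ?case by (auto simp: end_nbhd_def)
  qed auto
  then show thesis using that W(3) by blast
qed

lemma free_module_carrier_mono:
  "S \<subseteq> S' \<Longrightarrow> carrier (free_module R S) \<subseteq> carrier (free_module R S')"
  unfolding free_module_def by auto

text \<open>
  Control can be tested on the neighbourhood base \<open>end_nbhd T K (\<epsilon> K)\<close>, which removes the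
  topology of the compactification from all further arguments.
\<close>

lemma is_controlled_iff:
  "is_controlled R T (A, \<alpha>) (B, \<beta>) \<phi> \<longleftrightarrow>
    (\<forall>\<epsilon> \<in> freudenthal_ends T. \<forall>K. compactin T K \<longrightarrow>
      (\<exists>L. compactin T L \<and> (\<forall>a \<in> A. \<alpha> a \<in> \<epsilon> L \<longrightarrow>
         \<phi> (basis_elt R a) \<in> carrier (free_module R {b \<in> B. \<beta> b \<in> \<epsilon> K}))))"
    (is "_ \<longleftrightarrow> (\<forall>\<epsilon> \<in> _. \<forall>K. _ \<longrightarrow> ?P \<epsilon> K)")
proof -
  have Inl_iff: "Inl x \<in> end_nbhd T K W \<longleftrightarrow> x \<in> W" for x K W
    by (auto simp: end_nbhd_def)
  show ?thesis
  proof (intro iffI ballI allI impI)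
    fix \<epsilon> K assume c: "is_controlled R T (A, \<alpha>) (B, \<beta>) \<phi>" and \<epsilon>: "\<epsilon> \<in> freudenthal_ends T"
      and K: "compactin T K"
    obtain V where V: "nbhd_in (freudenthal_compactification T) (Inr \<epsilon>) V"
      "\<forall>a \<in> A. Inl (\<alpha> a) \<in> V \<longrightarrow>
         \<phi> (basis_elt R a) \<in> carrier (free_module R {b \<in> B. \<beta> b \<in> \<epsilon> K})"
      using c \<epsilon> nbhd_in_end_nbhd[OF \<epsilon> K] unfolding is_controlled_def by (fastforce simp: Inl_iff)
    obtain L where "compactin T L" "end_nbhd T L (\<epsilon> L) \<subseteq> V"
      using nbhd_in_contains_end_nbhd[OF \<epsilon> V(1)] .
    then show "?P \<epsilon> K"
      using V(2) Inl_iff by blast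
  next
    assume c: "\<forall>\<epsilon> \<in> freudenthal_ends T. \<forall>K. compactin T K \<longrightarrow> ?P \<epsilon> K"
    have "\<exists>V \<subseteq> U. nbhd_in (freudenthal_compactification T) (Inr \<epsilon>) V \<and>
         (\<forall>a \<in> A. Inl (\<alpha> a) \<in> V \<longrightarrow>
            \<phi> (basis_elt R a) \<in> carrier (free_module R {b \<in> B. Inl (\<beta> b) \<in> U}))"
      if \<epsilon>: "\<epsilon> \<in> freudenthal_ends T" and U: "nbhd_in (freudenthal_compactification T) (Inr \<epsilon>) U"
      for \<epsilon> U
    proof -
      obtain K where K: "compactin T K" "end_nbhd T K (\<epsilon> K) \<subseteq> U"
        using nbhd_in_contains_end_nbhd[OF \<epsilon> U] .
      then obtain L where L: "compactin T L" "\<forall>a \<in> A. \<alpha> a \<in> \<epsilon> L \<longrightarrow>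
         \<phi> (basis_elt R a) \<in> carrier (free_module R {b \<in> B. \<beta> b \<in> \<epsilon> K})"
        using c \<epsilon> by blast
      have KL: "compactin T (K \<union> L)"
        using K L by (simp add: compactin_Un)
      let ?V = "end_nbhd T (K \<union> L) (\<epsilon> (K \<union> L))"
      have "?V \<subseteq> U"
        using end_nbhd_mono[OF \<epsilon> K(1) KL] K(2) by blast
      moreover have "\<phi> (basis_elt R a) \<in> carrier (free_module R {b \<in> B. Inl (\<beta> b) \<in> U})"
        if "a \<in> A" "Inl (\<alpha> a) \<in> ?V" for a
      proof -
        have "\<alpha> a \<in> \<epsilon> L"
          using that(2) freudenthal_endsD(2)[OF \<epsilon> L(1) KL] by (auto simp: Inl_iff)
        then have "\<phi> (basis_elt R a) \<in> carrier (free_module R {b \<in> B. \<beta> b \<in> \<epsilon> K})"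
          using L(2) that(1) by blast
        moreover have "{b \<in> B. \<beta> b \<in> \<epsilon> K} \<subseteq> {b \<in> B. Inl (\<beta> b) \<in> U}"
          using K(2) Inl_iff by blast
        ultimately show ?thesis
          using free_module_carrier_mono by blast
      qed
      ultimately show ?thesis
        using nbhd_in_end_nbhd[OF \<epsilon> KL] by blast
    qed
    then show "is_controlled R T (A, \<alpha>) (B, \<beta>) \<phi>"
      unfolding is_controlled_def by simp
  qed
qed

lemma proper_map_discrete_iff:
  assumes "Hausdorff_space T" "locally_compact_space T" "\<alpha> \<in> A \<rightarrow> topspace T"
  shows "proper_map (discrete_topology A) T \<alpha> \<longleftrightarrow>
    (\<forall>K. compactin T K \<longrightarrow> finite {a \<in> A. \<alpha> a \<in> K})"
  using assms proper_eq_compact_map[of T "discrete_topology A" \<alpha>]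
    locally_compact_imp_k_space[of T] Hausdorff_imp_kc_space[of T]
  by (auto simp: compactin_discrete_topology Hausdorff_imp_kc_space)

text \<open>
  Suppose infinitely many basis elements \<open>c\<close> had images that involve an element over \<open>K\<close>. As \<open>\<gamma>\<close> is
  proper, the points \<open>\<gamma> c\<close> leave every compact set, so they accumulate at an end \<open>\<epsilon>\<close>. By control at \<open>\<epsilon>\<close>, the
  images of those \<open>c\<close> with \<open>\<gamma> c\<close> close to \<open>\<epsilon>\<close> live over \<open>\<epsilon> K\<close>, which is disjoint from \<open>K\<close>.
\<close>

lemma proper_controlled_hom_image_proper:
  assumes T: "is_tree T" and \<gamma>: "\<gamma> \<in> C \<rightarrow> topspace T"
    and fin: "\<And>K. compactin T K \<Longrightarrow> finite {c \<in> C. \<gamma> c \<in> K}"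
    and ctrl: "is_controlled R T (C, \<gamma>) (A, \<alpha>) \<phi>"
    and \<phi>: "\<And>c. c \<in> C \<Longrightarrow> \<phi> (basis_elt R c) \<in> carrier (free_module R A)"
    and K: "compactin T K"
  shows "finite {a. (\<exists>c \<in> C. \<phi> (basis_elt R c) a \<noteq> \<zero>\<^bsub>R\<^esub>) \<and> \<alpha> a \<in> K}"
proof -
  define C' where "C' = {c \<in> C. \<exists>a. \<phi> (basis_elt R c) a \<noteq> \<zero>\<^bsub>R\<^esub> \<and> \<alpha> a \<in> K}"
  have "finite C'"
  proof (rule ccontr)
    assume inf: "infinite C'"
    define F where "F = inf cofinite (principal C')"
    have evF: "eventually P F \<longleftrightarrow> finite {c \<in> C'. \<not> P c}" for P
      unfolding F_def eventually_inf_principal by (simp add: eventually_cofinite)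
    have "F \<noteq> bot"
      using inf evF[of "\<lambda>_. False"] by (auto simp: trivial_limit_def)
    moreover have "eventually (\<lambda>c. \<gamma> c \<in> topspace T - L) F" if "compactin T L" for L
    proof -
      have "{c \<in> C'. \<not> \<gamma> c \<in> topspace T - L} \<subseteq> {c \<in> C. \<gamma> c \<in> L}"
        using \<gamma> by (auto simp: C'_def)
      then show ?thesis
        unfolding evF using fin[OF that] finite_subset by blast
    qed
    ultimately obtain \<epsilon> where \<epsilon>: "\<epsilon> \<in> freudenthal_ends T"
      "\<And>K. compactin T K \<Longrightarrow> \<exists>\<^sub>F c in F. \<gamma> c \<in> \<epsilon> K"
      using filter_leaving_compacts_accumulates_at_end[OF T] by blast
    obtain L where L: "compactin T L" "\<forall>c \<in> C. \<gamma> c \<in> \<epsilon> L \<longrightarrow>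
         \<phi> (basis_elt R c) \<in> carrier (free_module R {a \<in> A. \<alpha> a \<in> \<epsilon> K})"
      using ctrl \<epsilon>(1) K unfolding is_controlled_iff by blast
    have "\<exists>\<^sub>F c in F. \<gamma> c \<in> \<epsilon> L \<and> c \<in> C'"
      by (rule frequently_eventually_frequently[OF \<epsilon>(2)[OF L(1)]]) (simp add: evF)
    then obtain c where c: "\<gamma> c \<in> \<epsilon> L" "c \<in> C'"
      by (rule frequentlyE) blast
    then obtain a where a: "\<phi> (basis_elt R c) a \<noteq> \<zero>\<^bsub>R\<^esub>" "\<alpha> a \<in> K"
      unfolding C'_def by blast
    have "\<phi> (basis_elt R c) \<in> carrier (free_module R {a \<in> A. \<alpha> a \<in> \<epsilon> K})"
      using L(2) c unfolding C'_def by blast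
    then have "\<alpha> a \<in> \<epsilon> K"
      using a(1) unfolding free_module_def by auto
    then show False
      using a(2) complement_componentsD(1)[OF freudenthal_endsD(1)[OF \<epsilon>(1) K]] by blast
  qed
  moreover have "finite {a. \<phi> (basis_elt R c) a \<noteq> \<zero>\<^bsub>R\<^esub>}" if "c \<in> C'" for c
    using \<phi>[of c] that unfolding C'_def free_module_def by simp
  ultimately have "finite (\<Union>c\<in>C'. {a. \<phi> (basis_elt R c) a \<noteq> \<zero>\<^bsub>R\<^esub>})"
    by blast
  then show ?thesis
    by (rule rev_finite_subset) (auto simp: C'_def)
qed

text \<open>
  If control over \<open>T'\<close> fails at the end \<open>\<epsilon>'\<close>, there are bad basis elements \<open>a\<close> with \<open>f (\<alpha> a)\<close>
  arbitrarily close to \<open>\<epsilon>'\<close>. Their points \<open>\<alpha> a\<close> leave every compact subset of \<open>T\<close> and accumulate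
  at an end \<open>\<epsilon>\<close> of \<open>T\<close>. The map \<open>f\<close> carries a neighbourhood of \<open>\<epsilon>\<close> into the given
  neighbourhood of \<open>\<epsilon>'\<close>, and control over \<open>T\<close> at \<open>\<epsilon>\<close> shows that some of the \<open>a\<close> are not bad.
\<close>

lemma is_controlled_change_of_tree:
  assumes T: "is_tree T" and T': "is_tree T'"
    and f: "continuous_map T T' f" "proper_map T T' f"
    and \<alpha>: "\<alpha> \<in> A \<rightarrow> topspace T"
    and ctrl: "is_controlled R T (A, \<alpha>) (B, \<beta>) \<phi>"
  shows "is_controlled R T' (A, compose A f \<alpha>) (B, compose B f \<beta>) \<phi>"
  unfolding is_controlled_iff
proof (intro ballI allI impI)
  fix \<epsilon>' K' assume \<epsilon>': "\<epsilon>' \<in> freudenthal_ends T'" and K': "compactin T' K'"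
  define Bad where "Bad = {a \<in> A.
    \<phi> (basis_elt R a) \<notin> carrier (free_module R {b \<in> B. compose B f \<beta> b \<in> \<epsilon>' K'})}"
  let ?G = "\<lambda>L'. {a \<in> Bad. f (\<alpha> a) \<in> \<epsilon>' L'}"
  show "\<exists>L'. compactin T' L' \<and> (\<forall>a \<in> A. compose A f \<alpha> a \<in> \<epsilon>' L' \<longrightarrow>
         \<phi> (basis_elt R a) \<in> carrier (free_module R {b \<in> B. compose B f \<beta> b \<in> \<epsilon>' K'}))"
  proof (rule ccontr)
    assume "\<not> ?thesis"
    then have bad: "?G L' \<noteq> {}" if "compactin T' L'" for L'
      using that unfolding Bad_def by (fastforce simp: compose_def)
    \<comment> \<open>The filter of bad basis elements tending to \<open>\<epsilon>'\<close>.\<close>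
    define F where "F = (INF L' \<in> {L'. compactin T' L'}. principal (?G L'))"
    have evF: "eventually P F \<longleftrightarrow> (\<exists>L'. compactin T' L' \<and> (\<forall>a \<in> ?G L'. P a))" for P
    proof -
      have "eventually P F \<longleftrightarrow> (\<exists>L' \<in> {L'. compactin T' L'}. eventually P (principal (?G L')))"
        unfolding F_def
      proof (rule eventually_INF_base)
        show "{L'. compactin T' L'} \<noteq> {}" using K' by blast
        fix L M assume "L \<in> {L'. compactin T' L'}" "M \<in> {L'. compactin T' L'}"
        then have "compactin T' (L \<union> M)" "\<epsilon>' (L \<union> M) \<subseteq> \<epsilon>' L" "\<epsilon>' (L \<union> M) \<subseteq> \<epsilon>' M"
          using freudenthal_endsD(2)[OF \<epsilon>', of _ "L \<union> M"] by (auto simp: compactin_Un)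
        then show "\<exists>x\<in>{L'. compactin T' L'}. principal (?G x) \<le> inf (principal (?G L)) (principal (?G M))"
          by (intro bexI[of _ "L \<union> M"]) auto
      qed
      then show ?thesis by (simp add: eventually_principal)
    qed
    have "F \<noteq> bot"
      unfolding trivial_limit_def evF using bad by blast
    moreover have "eventually (\<lambda>a. \<alpha> a \<in> topspace T - K) F" if K: "compactin T K" for K
      unfolding evF
    proof (intro exI conjI ballI)
      show fK: "compactin T' (f ` K)"
        using image_compactin[OF K f(1)] .
      show "\<alpha> a \<in> topspace T - K" if "a \<in> ?G (f ` K)" for a
        using that \<alpha> complement_componentsD(1)[OF freudenthal_endsD(1)[OF \<epsilon>' fK]]
        by (auto simp: Bad_def)
    qed
    ultimately obtain \<epsilon> where \<epsilon>: "\<epsilon> \<in> freudenthal_ends T"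
      "\<And>K. compactin T K \<Longrightarrow> \<exists>\<^sub>F a in F. \<alpha> a \<in> \<epsilon> K"
      using filter_leaving_compacts_accumulates_at_end[OF T] by blast
    \<comment> \<open>The preimage of \<open>K'\<close> cuts out the neighbourhood of \<open>\<epsilon>\<close> that \<open>f\<close> maps into \<open>\<epsilon>' K'\<close>.\<close>
    define K where "K = {x \<in> topspace T. f x \<in> K'}"
    have K: "compactin T K"
      unfolding K_def using compactin_proper_map_preimage[OF f(2) K'] by simp
    note \<epsilon>K = complement_componentsD[OF freudenthal_endsD(1)[OF \<epsilon>(1) K]]
    have "f ` \<epsilon> K \<subseteq> \<epsilon>' K'"
    proof (rule complement_components_maximal[OF freudenthal_endsD(1)[OF \<epsilon>' K']])
      show "path_connectedin T' (f ` \<epsilon> K)"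
        by (rule path_connectedin_continuous_map_image[OF f(1) \<epsilon>K(3)])
      show "f ` \<epsilon> K \<inter> K' = {}"
        using \<epsilon>K(1) by (auto simp: K_def)
      have "\<exists>\<^sub>F a in F. \<alpha> a \<in> \<epsilon> K \<and> f (\<alpha> a) \<in> \<epsilon>' K'"
        by (rule frequently_eventually_frequently[OF \<epsilon>(2)[OF K]]) (use evF K' in blast)
      then show "\<epsilon>' K' \<inter> f ` \<epsilon> K \<noteq> {}"
        by (rule frequentlyE) blast
    qed
    obtain L where L: "compactin T L" "\<forall>a \<in> A. \<alpha> a \<in> \<epsilon> L \<longrightarrow>
         \<phi> (basis_elt R a) \<in> carrier (free_module R {b \<in> B. \<beta> b \<in> \<epsilon> K})"
      using ctrl \<epsilon>(1) K unfolding is_controlled_iff by blast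
    have "\<exists>\<^sub>F a in F. \<alpha> a \<in> \<epsilon> L \<and> a \<in> Bad"
      by (rule frequently_eventually_frequently[OF \<epsilon>(2)[OF L(1)]]) (use evF K' in blast)
    then obtain a where a: "\<alpha> a \<in> \<epsilon> L" "a \<in> Bad"
      by (rule frequentlyE) blast
    then have "\<phi> (basis_elt R a) \<in> carrier (free_module R {b \<in> B. \<beta> b \<in> \<epsilon> K})"
      using L(2) unfolding Bad_def by blast
    moreover have "{b \<in> B. \<beta> b \<in> \<epsilon> K} \<subseteq> {b \<in> B. compose B f \<beta> b \<in> \<epsilon>' K'}"
      using \<open>f ` \<epsilon> K \<subseteq> \<epsilon>' K'\<close> by (auto simp: compose_def)
    ultimately show False
      using a(2) free_module_carrier_mono unfolding Bad_def by blast
  qed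
qed

section \<open>Universal arrows and left adjoints\<close>

lemma full_subcategory_simps [simp]:
  "obj (full_subcategory C S) = obj C \<inter> S" "arr (full_subcategory C S) = arr C"
  "ident (full_subcategory C S) = ident C" "cmp (full_subcategory C S) = cmp C"
  by (simp_all add: full_subcategory_def)

lemma full_subcategory_ab_simps [simp]:
  "hadd (full_subcategory C S) = hadd C" "hzero (full_subcategory C S) = hzero C"
  by (simp_all add: full_subcategory_def)

lemma category_full_subcategory: "category C \<Longrightarrow> category (full_subcategory C S)"
proof -
  assume "category C"
  then interpret category C .
  show ?thesis
    by unfold_locales
      (simp_all add: ident_arr comp_arr comp_ident_right comp_ident_left comp_assoc)
qed

lemma is_functorD:
  assumes "is_functor C D F"
  shows "category C" "category D" "\<And>X. X \<in> obj C \<Longrightarrow> fob F X \<in> obj D"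
    "\<And>X Y f. \<lbrakk>X \<in> obj C; Y \<in> obj C; f \<in> arr C X Y\<rbrakk> \<Longrightarrow> fmor F X Y f \<in> arr D (fob F X) (fob F Y)"
    "\<And>X. X \<in> obj C \<Longrightarrow> fmor F X X (ident C X) = ident D (fob F X)"
    "\<And>X Y Z f g. \<lbrakk>X \<in> obj C; Y \<in> obj C; Z \<in> obj C; f \<in> arr C X Y; g \<in> arr C Y Z\<rbrakk> \<Longrightarrow>
        fmor F X Z (cmp C X Y Z g f)
          = cmp D (fob F X) (fob F Y) (fob F Z) (fmor F Y Z g) (fmor F X Y f)"
  using assms unfolding is_functor_def by simp_all

lemma is_functor_functor_comp:
  assumes F: "is_functor C D F" and G: "is_functor D E G"
  shows "is_functor C E (functor_comp G F)"
  unfolding is_functor_def functor_comp_def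
  using is_functorD[OF F] is_functorD[OF G] by simp

text \<open>
  If \<open>\<eta> X : Y X \<rightarrow> U (G X)\<close> is a universal arrow from \<open>Y X\<close> to \<open>U\<close> for every \<open>X\<close>, then \<open>G X\<close> has the property
  that characterises \<open>L (Y X)\<close>, whose universal arrow is the unit \<open>u X\<close> of the adjunction.
  The isomorphism \<open>v X\<close> is the factorisation of \<open>u X\<close> through \<open>\<eta> X\<close>, and its naturality follows
  from the uniqueness of such factorisations.
\<close>

lemma left_adjoint_naturally_isomorphic:
  assumes adj: "is_left_adjoint C D L U"
    and Y: "is_functor E C Y" and G: "is_functor E D G"
    and \<eta>: "\<And>X. X \<in> obj E \<Longrightarrow> \<eta> X \<in> arr C (fob Y X) (fob U (fob G X))"
    and \<eta>_nat: "\<And>X X' h. \<lbrakk>X \<in> obj E; X' \<in> obj E; h \<in> arr E X X'\<rbrakk> \<Longrightarrow>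
      cmp C (fob Y X) (fob Y X') (fob U (fob G X')) (\<eta> X') (fmor Y X X' h)
        = cmp C (fob Y X) (fob U (fob G X)) (fob U (fob G X'))
            (fmor U (fob G X) (fob G X') (fmor G X X' h)) (\<eta> X)"
    and univ: "\<And>X N \<theta>. \<lbrakk>X \<in> obj E; N \<in> obj D; \<theta> \<in> arr C (fob Y X) (fob U N)\<rbrakk> \<Longrightarrow>
      \<exists>!\<tau>. \<tau> \<in> arr D (fob G X) N \<and>
        cmp C (fob Y X) (fob U (fob G X)) (fob U N) (fmor U (fob G X) N \<tau>) (\<eta> X) = \<theta>"
  shows "naturally_isomorphic E D G (functor_comp L Y)"
proof -
  have L: "is_functor C D L" and U: "is_functor D C U"
    using adj unfolding is_left_adjoint_def by auto
  obtain \<Phi> where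
    bij: "\<forall>X \<in> obj C. \<forall>N \<in> obj D. bij_betw (\<Phi> X N) (arr D (fob L X) N) (arr C X (fob U N))"
    and nat1: "\<forall>X' \<in> obj C. \<forall>X \<in> obj C. \<forall>N \<in> obj D. \<forall>f \<in> arr C X' X. \<forall>h \<in> arr D (fob L X) N.
         \<Phi> X' N (cmp D (fob L X') (fob L X) N h (fmor L X' X f))
           = cmp C X' X (fob U N) (\<Phi> X N h) f"
    and nat2: "\<forall>X \<in> obj C. \<forall>N \<in> obj D. \<forall>N' \<in> obj D. \<forall>k \<in> arr D N N'. \<forall>h \<in> arr D (fob L X) N.
         \<Phi> X N' (cmp D (fob L X) N N' k h)
           = cmp C X (fob U N) (fob U N') (fmor U N N' k) (\<Phi> X N h)"
    using adj unfolding is_left_adjoint_def by (elim conjE exE) (rule that)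
  note bij = bij[rule_format] and nat1 = nat1[rule_format] and nat2 = nat2[rule_format]
  interpret C: category C using is_functorD(1)[OF L] .
  interpret D: category D using is_functorD(2)[OF L] .
  note obs = is_functorD(3)[OF Y] is_functorD(3)[OF G] is_functorD(3)[OF L] is_functorD(3)[OF U]
  note mors = is_functorD(4)[OF Y] is_functorD(4)[OF G] is_functorD(4)[OF L] is_functorD(4)[OF U]
  let ?LY = "\<lambda>X. fob L (fob Y X)"
  let ?LYm = "\<lambda>X X' h. fmor L (fob Y X) (fob Y X') (fmor Y X X' h)"
  define res where "res = (\<lambda>X N \<tau>. cmp C (fob Y X) (fob U (fob G X)) (fob U N)
     (fmor U (fob G X) N \<tau>) (\<eta> X))"
  have univ': "\<exists>!\<tau>. \<tau> \<in> arr D (fob G X) N \<and> res X N \<tau> = \<theta>"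
    if "X \<in> obj E" "N \<in> obj D" "\<theta> \<in> arr C (fob Y X) (fob U N)" for X N \<theta>
    unfolding res_def by (rule univ[OF that])
  have res_arr: "res X N \<tau> \<in> arr C (fob Y X) (fob U N)"
    if "X \<in> obj E" "N \<in> obj D" "\<tau> \<in> arr D (fob G X) N" for X N \<tau>
    unfolding res_def using that \<eta> by (auto intro!: C.comp_arr obs mors)
  have res_inj: "\<tau> = \<tau>'" if "X \<in> obj E" "N \<in> obj D" "\<tau> \<in> arr D (fob G X) N"
      "\<tau>' \<in> arr D (fob G X) N" "res X N \<tau> = res X N \<tau>'" for X N \<tau> \<tau>'
    using univ'[OF that(1,2) res_arr[OF that(1-3)]] that by metis
  have res_comp: "res X N' (cmp D (fob G X) N N' k \<tau>)
      = cmp C (fob Y X) (fob U N) (fob U N') (fmor U N N' k) (res X N \<tau>)"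
    if "X \<in> obj E" "N \<in> obj D" "N' \<in> obj D" "k \<in> arr D N N'" "\<tau> \<in> arr D (fob G X) N" for X N N' k \<tau>
    unfolding res_def using that \<eta>
    by (simp add: is_functorD(6)[OF U] obs mors C.comp_assoc)
  have res_id: "res X (fob G X) (ident D (fob G X)) = \<eta> X" if "X \<in> obj E" for X
    unfolding res_def using that \<eta> by (simp add: is_functorD(5)[OF U] obs C.comp_ident_left)
  define u where "u = (\<lambda>X. \<Phi> (fob Y X) (?LY X) (ident D (?LY X)))"
  have u: "u X \<in> arr C (fob Y X) (fob U (?LY X))" if "X \<in> obj E" for X
    unfolding u_def using bij_betwE[OF bij[of "fob Y X" "?LY X"]] that
    by (auto intro!: obs D.ident_arr)
  have \<Phi>_eq: "\<Phi> (fob Y X) N h = cmp C (fob Y X) (fob U (?LY X)) (fob U N) (fmor U (?LY X) N h) (u X)"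
    if "X \<in> obj E" "N \<in> obj D" "h \<in> arr D (?LY X) N" for X N h
    using nat2[of "fob Y X" "?LY X" N h "ident D (?LY X)"] that
    by (simp add: u_def obs D.ident_arr D.comp_ident_right)
  define v where "v = (\<lambda>X. THE \<tau>. \<tau> \<in> arr D (fob G X) (?LY X) \<and> res X (?LY X) \<tau> = u X)"
  have v: "v X \<in> arr D (fob G X) (?LY X)" "res X (?LY X) (v X) = u X" if "X \<in> obj E" for X
    using theI'[OF univ'[OF that _ u[OF that]]] that obs unfolding v_def by auto
  have iso: "iso_arr D (fob G X) (?LY X) (v X)" if X: "X \<in> obj E" for X
  proof -
    \<comment> \<open>The inverse of \<open>v X\<close> is the transpose of \<open>\<eta> X\<close>.\<close>
    have "\<eta> X \<in> \<Phi> (fob Y X) (fob G X) ` arr D (?LY X) (fob G X)"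
      using bij[of "fob Y X" "fob G X"] \<eta>[OF X] X obs unfolding bij_betw_def by auto
    then obtain \<kappa> where \<kappa>: "\<kappa> \<in> arr D (?LY X) (fob G X)" "\<Phi> (fob Y X) (fob G X) \<kappa> = \<eta> X"
      by auto
    note obX = obs(1)[OF X] obs(2)[OF X] obs(3)[OF obs(1)[OF X]]
    have "cmp D (fob G X) (?LY X) (fob G X) \<kappa> (v X) = ident D (fob G X)"
    proof (rule res_inj[OF X])
      show "res X (fob G X) (cmp D (fob G X) (?LY X) (fob G X) \<kappa> (v X))
          = res X (fob G X) (ident D (fob G X))"
        using res_comp[OF X obX(3,2) \<kappa>(1) v(1)[OF X]] \<Phi>_eq[OF X obX(2) \<kappa>(1)] \<kappa>(2)
        by (simp add: v(2)[OF X] res_id[OF X])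
    qed (use obX \<kappa>(1) v(1)[OF X] in \<open>auto intro: D.comp_arr D.ident_arr\<close>)
    moreover have "cmp D (?LY X) (fob G X) (?LY X) (v X) \<kappa> = ident D (?LY X)"
    proof (rule bij_betw_imp_inj_on[OF bij[OF obX(1,3)], THEN inj_onD])
      show "\<Phi> (fob Y X) (?LY X) (cmp D (?LY X) (fob G X) (?LY X) (v X) \<kappa>)
          = \<Phi> (fob Y X) (?LY X) (ident D (?LY X))"
        using nat2[OF obX(1,2,3) v(1)[OF X] \<kappa>(1)] v(2)[OF X] \<kappa>(2)
        by (simp add: u_def res_def)
    qed (use obX \<kappa>(1) v(1)[OF X] in \<open>auto intro: D.comp_arr D.ident_arr\<close>)
    ultimately show ?thesis
      unfolding iso_arr_def using \<kappa>(1) v(1)[OF X] by blast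
  qed
  have nat: "cmp D (fob G X) (fob G X') (?LY X') (v X') (fmor G X X' h)
      = cmp D (fob G X) (?LY X) (?LY X') (?LYm X X' h) (v X)"
    if X: "X \<in> obj E" and X': "X' \<in> obj E" and h: "h \<in> arr E X X'" for X X' h
  proof (rule res_inj[OF X])
    note obX = obs(1)[OF X] obs(2)[OF X] obs(3)[OF obs(1)[OF X]]
    note obX' = obs(1)[OF X'] obs(2)[OF X'] obs(3)[OF obs(1)[OF X']]
    have Yh: "fmor Y X X' h \<in> arr C (fob Y X) (fob Y X')"
      and Gh: "fmor G X X' h \<in> arr D (fob G X) (fob G X')"
      using mors X X' h by auto
    have LYh: "?LYm X X' h \<in> arr D (?LY X) (?LY X')"
      using mors(3)[OF obX(1) obX'(1) Yh] .
    have vX: "v X \<in> arr D (fob G X) (?LY X)" "v X' \<in> arr D (fob G X') (?LY X')"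
      using v(1) X X' by auto
    show "?LY X' \<in> obj D" by (rule obX'(3))
    show "cmp D (fob G X) (fob G X') (?LY X') (v X') (fmor G X X' h) \<in> arr D (fob G X) (?LY X')"
      "cmp D (fob G X) (?LY X) (?LY X') (?LYm X X' h) (v X) \<in> arr D (fob G X) (?LY X')"
      using obX obX' Gh LYh vX by (auto intro: D.comp_arr)
    have "res X (fob G X') (fmor G X X' h)
        = cmp C (fob Y X) (fob Y X') (fob U (fob G X')) (\<eta> X') (fmor Y X X' h)"
      unfolding res_def using \<eta>_nat[OF X X' h] by simp
    then have "res X (?LY X') (cmp D (fob G X) (fob G X') (?LY X') (v X') (fmor G X X' h))
        = cmp C (fob Y X) (fob Y X') (fob U (?LY X')) (res X' (?LY X') (v X')) (fmor Y X X' h)"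
      using res_comp[OF X obX'(2,3) vX(2) Gh] obX(1) obX' Yh \<eta>[OF X'] vX(2)
      by (simp add: res_def obs mors C.comp_assoc)
    also have "\<dots> = cmp C (fob Y X) (fob Y X') (fob U (?LY X')) (u X') (fmor Y X X' h)"
      by (simp add: v(2)[OF X'])
    also have "\<dots> = \<Phi> (fob Y X) (?LY X') (?LYm X X' h)"
      using nat1[OF obX(1) obX'(1) obX'(3) Yh D.ident_arr[OF obX'(3)]] LYh obX obX'
      by (simp add: u_def D.comp_ident_left)
    also have "\<dots> = res X (?LY X') (cmp D (fob G X) (?LY X) (?LY X') (?LYm X X' h) (v X))"
      using \<Phi>_eq[OF X obX'(3) LYh] res_comp[OF X obX(3) obX'(3) LYh vX(1)]
      by (simp add: v(2)[OF X])
    finally show "res X (?LY X') (cmp D (fob G X) (fob G X') (?LY X') (v X') (fmor G X X' h))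
      = res X (?LY X') (cmp D (fob G X) (?LY X) (?LY X') (?LYm X X' h) (v X))" .
  qed
  have "is_nat_trans E D G (functor_comp L Y) (\<lambda>X \<in> obj E. v X)"
    unfolding is_nat_trans_def
    using G is_functor_functor_comp[OF Y L] v(1) nat by (simp add: functor_comp_def)
  then show ?thesis
    unfolding naturally_isomorphic_def using iso
    by (intro exI[of _ "\<lambda>X \<in> obj E. v X"]) (simp add: functor_comp_def)
qed

section \<open>Modules over a preadditive category\<close>

lemma Ab_cat_simps [simp]:
  "obj Ab_cat = {G. comm_group G}" "arr Ab_cat G H = hom G H \<inter> extensional (carrier G)"
  "ident Ab_cat G = (\<lambda>x \<in> carrier G. x)" "cmp Ab_cat G H K g f = compose (carrier G) g f"
  by (simp_all add: Ab_cat_def)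

lemma category_Ab_cat: "category Ab_cat"
proof
  fix G H K :: "'g monoid" and f g :: "'g \<Rightarrow> 'g"
  assume "G \<in> obj Ab_cat" "f \<in> arr Ab_cat G H" "g \<in> arr Ab_cat H K"
  then show "cmp Ab_cat G H K g f \<in> arr Ab_cat G K"
    by (auto simp: hom_def compose_def Pi_iff comm_group_def comm_monoid_def monoid.m_closed)
next
  fix G H :: "'g monoid" and f :: "'g \<Rightarrow> 'g"
  assume "f \<in> arr Ab_cat G H"
  then show "cmp Ab_cat G G H f (ident Ab_cat G) = f" "cmp Ab_cat G H H (ident Ab_cat H) f = f"
    by (auto simp: compose_def hom_def Pi_iff fun_eq_iff extensional_def)
next
  fix G H K M :: "'g monoid" and f g h :: "'g \<Rightarrow> 'g"
  assume "f \<in> arr Ab_cat G H"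
  then show "cmp Ab_cat G K M h (cmp Ab_cat G H K g f) = cmp Ab_cat G H M (cmp Ab_cat H K M h g) f"
    by (auto simp: compose_def hom_def Pi_iff fun_eq_iff)
next
  fix G :: "'g monoid"
  assume "G \<in> obj Ab_cat"
  then show "ident Ab_cat G \<in> arr Ab_cat G G"
    by (auto simp: hom_def comm_group_def comm_monoid_def monoid.m_closed)
qed

lemma op_cat_simps [simp]:
  "obj (op_cat C) = obj C" "arr (op_cat C) X Y = arr C Y X" "ident (op_cat C) = ident C"
  "cmp (op_cat C) X Y Z g f = cmp C Z Y X f g"
  "hadd (op_cat C) X Y = hadd C Y X"  "hzero (op_cat C) X Y = hzero C Y X"
  by (simp_all add: op_cat_def)

lemma category_op_cat: "category C \<Longrightarrow> category (op_cat C)"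
proof -
  assume "category C"
  then interpret category C .
  show ?thesis
    by unfold_locales
      (simp_all add: ident_arr comp_arr comp_ident_right comp_ident_left comp_assoc)
qed

locale preadditive = category C for C :: "('o, 'm) ab_cat" +
  assumes hom_group: "\<lbrakk>X \<in> obj C; Y \<in> obj C\<rbrakk> \<Longrightarrow> comm_group (hom_group C X Y)"
    and comp_hadd_right: "\<lbrakk>X \<in> obj C; Y \<in> obj C; Z \<in> obj C; f \<in> arr C X Y; f' \<in> arr C X Y;
        g \<in> arr C Y Z\<rbrakk>
      \<Longrightarrow> cmp C X Y Z g (hadd C X Y f f') = hadd C X Z (cmp C X Y Z g f) (cmp C X Y Z g f')"
    and comp_hadd_left: "\<lbrakk>X \<in> obj C; Y \<in> obj C; Z \<in> obj C; f \<in> arr C X Y;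
        g \<in> arr C Y Z; g' \<in> arr C Y Z\<rbrakk>
      \<Longrightarrow> cmp C X Y Z (hadd C Y Z g g') f = hadd C X Z (cmp C X Y Z g f) (cmp C X Y Z g' f)"
begin

lemma hadd_arr: "\<lbrakk>X \<in> obj C; Y \<in> obj C; f \<in> arr C X Y; g \<in> arr C X Y\<rbrakk> \<Longrightarrow> hadd C X Y f g \<in> arr C X Y"
  using hom_group[of X Y] monoid.m_closed[of "hom_group C X Y" f g]
  by (auto simp: comm_group_def comm_monoid_def hom_group_def)

end

lemma preadditive_full_subcategory: "preadditive C \<Longrightarrow> preadditive (full_subcategory C S)"
proof -
  assume "preadditive C"
  then interpret preadditive C .
  interpret S: category "full_subcategory C S"
    by (rule category_full_subcategory) unfold_locales
  show ?thesis
  proof (intro preadditive.intro preadditive_axioms.intro S.category_axioms)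
    fix X Y assume "X \<in> obj (full_subcategory C S)" "Y \<in> obj (full_subcategory C S)"
    then show "comm_group (Defs.hom_group (full_subcategory C S) X Y)"
      using hom_group[of X Y] by (simp add: hom_group_def)
  qed (simp_all add: comp_hadd_right comp_hadd_left)
qed

lemma mod_cat_simps:
  "obj (mod_cat A) = {M. is_additive_functor (op_cat A) Ab_cat M}"
  "arr (mod_cat A) M N = {\<eta>. is_nat_trans (op_cat A) Ab_cat M N \<eta>}"
  "ident (mod_cat A) M = (\<lambda>X \<in> obj A. \<lambda>x \<in> carrier (fob M X). x)"
  "cmp (mod_cat A) M N K \<theta> \<eta> = (\<lambda>X \<in> obj A. compose (carrier (fob M X)) (\<theta> X) (\<eta> X))"
  by (auto simp: mod_cat_def functor_category_def is_additive_functor_def)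

lemma mod_cat_objD:
  assumes "M \<in> obj (mod_cat A)"
  shows "\<And>X. X \<in> obj A \<Longrightarrow> comm_group (fob M X)"
    "\<And>X Y f. \<lbrakk>X \<in> obj A; Y \<in> obj A; f \<in> arr A Y X\<rbrakk> \<Longrightarrow> fmor M X Y f \<in> hom (fob M X) (fob M Y)"
    "\<And>X Y f. \<lbrakk>X \<in> obj A; Y \<in> obj A; f \<in> arr A Y X\<rbrakk> \<Longrightarrow> fmor M X Y f \<in> extensional (carrier (fob M X))"
    "\<And>X x. \<lbrakk>X \<in> obj A; x \<in> carrier (fob M X)\<rbrakk> \<Longrightarrow> fmor M X X (ident A X) x = x"
    "\<And>X Y Z f g x. \<lbrakk>X \<in> obj A; Y \<in> obj A; Z \<in> obj A; f \<in> arr A Y X; g \<in> arr A Z Y;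
        x \<in> carrier (fob M X)\<rbrakk> \<Longrightarrow> fmor M X Z (cmp A Z Y X f g) x = fmor M Y Z g (fmor M X Y f x)"
    "\<And>X Y f g x. \<lbrakk>X \<in> obj A; Y \<in> obj A; f \<in> arr A Y X; g \<in> arr A Y X; x \<in> carrier (fob M X)\<rbrakk>
        \<Longrightarrow> fmor M X Y (hadd A Y X f g) x = fmor M X Y f x \<otimes>\<^bsub>fob M Y\<^esub> fmor M X Y g x"
proof -
  have M: "is_functor (op_cat A) Ab_cat M"
    and add: "\<And>X Y. X \<in> obj A \<Longrightarrow> Y \<in> obj A \<Longrightarrow>
      fmor M X Y \<in> hom (hom_group (op_cat A) X Y) (hom_group Ab_cat (fob M X) (fob M Y))"
    using assms by (auto simp: mod_cat_simps is_additive_functor_def)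
  note M = is_functorD[OF M, simplified]
  show "\<And>X. X \<in> obj A \<Longrightarrow> comm_group (fob M X)"
    using M(3) .
  show "\<And>X Y f. \<lbrakk>X \<in> obj A; Y \<in> obj A; f \<in> arr A Y X\<rbrakk> \<Longrightarrow> fmor M X Y f \<in> hom (fob M X) (fob M Y)"
    "\<And>X Y f. \<lbrakk>X \<in> obj A; Y \<in> obj A; f \<in> arr A Y X\<rbrakk> \<Longrightarrow> fmor M X Y f \<in> extensional (carrier (fob M X))"
    using M(4) by auto
  show "\<And>X x. \<lbrakk>X \<in> obj A; x \<in> carrier (fob M X)\<rbrakk> \<Longrightarrow> fmor M X X (ident A X) x = x"
    using M(5) by simp
  show "\<And>X Y Z f g x. \<lbrakk>X \<in> obj A; Y \<in> obj A; Z \<in> obj A; f \<in> arr A Y X; g \<in> arr A Z Y;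
        x \<in> carrier (fob M X)\<rbrakk> \<Longrightarrow> fmor M X Z (cmp A Z Y X f g) x = fmor M Y Z g (fmor M X Y f x)"
    using M(6) by (simp add: compose_def)
  show "\<And>X Y f g x. \<lbrakk>X \<in> obj A; Y \<in> obj A; f \<in> arr A Y X; g \<in> arr A Y X; x \<in> carrier (fob M X)\<rbrakk>
        \<Longrightarrow> fmor M X Y (hadd A Y X f g) x = fmor M X Y f x \<otimes>\<^bsub>fob M Y\<^esub> fmor M X Y g x"
    using hom_mult[OF add] by (simp add: hom_group_def Ab_cat_def)
qed

text \<open>
  Together with its converse \<open>mod_cat_objD\<close> and the corresponding rules for arrows this allows
  modules and their maps to be treated elementwise, and not through equations between composites
  of extensional functions.
\<close>

lemma (in preadditive) mod_cat_objI:
  assumes grp: "\<And>X. X \<in> obj C \<Longrightarrow> comm_group (fob M X)"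
    and hom: "\<And>X Y f. \<lbrakk>X \<in> obj C; Y \<in> obj C; f \<in> arr C Y X\<rbrakk> \<Longrightarrow>
      fmor M X Y f \<in> hom (fob M X) (fob M Y) \<inter> extensional (carrier (fob M X))"
    and id: "\<And>X x. \<lbrakk>X \<in> obj C; x \<in> carrier (fob M X)\<rbrakk> \<Longrightarrow> fmor M X X (ident C X) x = x"
    and comp: "\<And>X Y Z f g x. \<lbrakk>X \<in> obj C; Y \<in> obj C; Z \<in> obj C; f \<in> arr C Y X; g \<in> arr C Z Y;
        x \<in> carrier (fob M X)\<rbrakk> \<Longrightarrow> fmor M X Z (cmp C Z Y X f g) x = fmor M Y Z g (fmor M X Y f x)"
    and add: "\<And>X Y f g x. \<lbrakk>X \<in> obj C; Y \<in> obj C; f \<in> arr C Y X; g \<in> arr C Y X; x \<in> carrier (fob M X)\<rbrakk>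
        \<Longrightarrow> fmor M X Y (hadd C Y X f g) x = fmor M X Y f x \<otimes>\<^bsub>fob M Y\<^esub> fmor M X Y g x"
  shows "M \<in> obj (mod_cat C)"
proof -
  have eqI: "u = v" if "u \<in> extensional (carrier G)" "v \<in> extensional (carrier G)"
    "\<And>x. x \<in> carrier G \<Longrightarrow> u x = v x" for u v and G :: "'b monoid"
    using that by (rule extensionalityI)
  have "is_functor (op_cat C) Ab_cat M"
    unfolding is_functor_def
  proof (intro conjI ballI)
    show "category (op_cat C)" "category Ab_cat"
      by (rule category_op_cat[OF category_axioms] category_Ab_cat)+
    fix X assume X: "X \<in> obj (op_cat C)"
    show "fob M X \<in> obj Ab_cat" using grp X by simp
    show "fmor M X X (ident (op_cat C) X) = ident Ab_cat (fob M X)"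
      using X hom[of X X "ident C X"] id ident_arr by (intro eqI[of _ "fob M X"]) auto
    fix Y assume Y: "Y \<in> obj (op_cat C)"
    show "fmor M X Y f \<in> arr Ab_cat (fob M X) (fob M Y)" if "f \<in> arr (op_cat C) X Y" for f
      using hom X Y that by simp
    show "fmor M X Z (cmp (op_cat C) X Y Z g f)
          = cmp Ab_cat (fob M X) (fob M Y) (fob M Z) (fmor M Y Z g) (fmor M X Y f)"
      if "Z \<in> obj (op_cat C)" "f \<in> arr (op_cat C) X Y" "g \<in> arr (op_cat C) Y Z" for Z f g
      using X Y that hom[of X Z "cmp C Z Y X f g"] comp comp_arr
      by (intro eqI[of _ "fob M X"]) (auto simp: compose_def)
  qed
  moreover have "fmor M X Y \<in> hom (Defs.hom_group (op_cat C) X Y) (Defs.hom_group Ab_cat (fob M X) (fob M Y))"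
    if "X \<in> obj C" "Y \<in> obj C" for X Y
  proof -
    have "fmor M X Y (hadd C Y X f g) = (\<lambda>x \<in> carrier (fob M X). fmor M X Y f x \<otimes>\<^bsub>fob M Y\<^esub> fmor M X Y g x)"
      if fg: "f \<in> arr C Y X" "g \<in> arr C Y X" for f g
      using \<open>X \<in> obj C\<close> \<open>Y \<in> obj C\<close> fg add hom[of X Y "hadd C Y X f g"] hadd_arr
      by (intro eqI[of _ "fob M X"]) auto
    then show ?thesis
      using that hom[of X Y] by (intro homI) (auto simp: hom_group_def Ab_cat_def)
  qed
  ultimately show ?thesis
    by (simp add: mod_cat_simps is_additive_functor_def)
qed

lemma mod_cat_arrD:
  assumes "\<eta> \<in> arr (mod_cat A) M N"
  shows "\<eta> \<in> extensional (obj A)"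
    "\<And>X. X \<in> obj A \<Longrightarrow> \<eta> X \<in> hom (fob M X) (fob N X)"
    "\<And>X. X \<in> obj A \<Longrightarrow> \<eta> X \<in> extensional (carrier (fob M X))"
    "\<And>X Y f x. \<lbrakk>X \<in> obj A; Y \<in> obj A; f \<in> arr A Y X; x \<in> carrier (fob M X)\<rbrakk> \<Longrightarrow>
       \<eta> Y (fmor M X Y f x) = fmor N X Y f (\<eta> X x)"
proof -
  have \<eta>: "\<eta> \<in> (\<Pi>\<^sub>E X \<in> obj A. hom (fob M X) (fob N X) \<inter> extensional (carrier (fob M X)))"
     "\<And>X Y f. \<lbrakk>X \<in> obj A; Y \<in> obj A; f \<in> arr A Y X\<rbrakk> \<Longrightarrow>
       compose (carrier (fob M X)) (\<eta> Y) (fmor M X Y f) = compose (carrier (fob M X)) (fmor N X Y f) (\<eta> X)"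
    using assms by (auto simp: mod_cat_simps is_nat_trans_def)
  show "\<eta> \<in> extensional (obj A)"
    using \<eta>(1) by (simp add: PiE_def)
  show "\<And>X. X \<in> obj A \<Longrightarrow> \<eta> X \<in> hom (fob M X) (fob N X)"
    "\<And>X. X \<in> obj A \<Longrightarrow> \<eta> X \<in> extensional (carrier (fob M X))"
    using PiE_mem[OF \<eta>(1)] by auto
  show "\<eta> Y (fmor M X Y f x) = fmor N X Y f (\<eta> X x)"
    if "X \<in> obj A" "Y \<in> obj A" "f \<in> arr A Y X" "x \<in> carrier (fob M X)" for X Y f x
    using fun_cong[OF \<eta>(2)[OF that(1-3)], of x] that(4) by (simp add: compose_def)
qed

lemma mod_cat_arrI:
  assumes M: "M \<in> obj (mod_cat A)" and N: "N \<in> obj (mod_cat A)"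
    and "\<eta> \<in> extensional (obj A)"
    "\<And>X. X \<in> obj A \<Longrightarrow> \<eta> X \<in> hom (fob M X) (fob N X) \<inter> extensional (carrier (fob M X))"
    "\<And>X Y f x. \<lbrakk>X \<in> obj A; Y \<in> obj A; f \<in> arr A Y X; x \<in> carrier (fob M X)\<rbrakk> \<Longrightarrow>
       \<eta> Y (fmor M X Y f x) = fmor N X Y f (\<eta> X x)"
  shows "\<eta> \<in> arr (mod_cat A) M N"
proof -
  have "is_functor (op_cat A) Ab_cat M" "is_functor (op_cat A) Ab_cat N"
    using M N by (auto simp: mod_cat_simps is_additive_functor_def)
  moreover have "compose (carrier (fob M X)) (\<eta> Y) (fmor M X Y f) = compose (carrier (fob M X)) (fmor N X Y f) (\<eta> X)"
    if "X \<in> obj A" "Y \<in> obj A" "f \<in> arr A Y X" for X Y f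
    using assms(5)[OF that] by (auto simp: compose_def)
  moreover have "\<eta> \<in> (\<Pi>\<^sub>E X \<in> obj A. hom (fob M X) (fob N X) \<inter> extensional (carrier (fob M X)))"
    using assms(3,4) by (simp add: PiE_def)
  ultimately show ?thesis
    by (simp add: mod_cat_simps is_nat_trans_def)
qed

section \<open>Hom functors\<close>

lemma comm_group_image_group:
  assumes "comm_group G" "inj_on j (carrier G)"
  shows "comm_group (image_group j G)"
proof -
  interpret G: comm_group G by (rule assms(1))
  note [simp] = image_group_def inv_into_f_f[OF assms(2)]
  show ?thesis
  proof (rule comm_groupI)
    fix x assume "x \<in> carrier (image_group j G)"
    then obtain u where "u \<in> carrier G" "x = j u" by auto
    then show "\<exists>y\<in>carrier (image_group j G). y \<otimes>\<^bsub>image_group j G\<^esub> x = \<one>\<^bsub>image_group j G\<^esub>"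
      by (intro bexI[of _ "j (inv\<^bsub>G\<^esub> u)"]) auto
  qed (auto simp: G.m_ac)
qed

lemma hom_functor_simps:
  assumes "inj j"
  shows "carrier (fob (hom_functor j C Y) X) = j ` arr C X Y"
    "\<lbrakk>u \<in> arr C X Y; v \<in> arr C X Y\<rbrakk> \<Longrightarrow> j u \<otimes>\<^bsub>fob (hom_functor j C Y) X\<^esub> j v = j (hadd C X Y u v)"
    "u \<in> arr C X Y \<Longrightarrow> fmor (hom_functor j C Y) X X' f (j u) = j (cmp C X' X Y u f)"
    "fmor (hom_functor j C Y) X X' f \<in> extensional (j ` arr C X Y)"
  using inj_on_subset[OF assms] by (simp_all add: hom_functor_def image_group_def hom_group_def)

lemma (in preadditive) hom_functor_mod:
  assumes j: "inj j" and Y: "Y \<in> obj C"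
  shows "hom_functor j C Y \<in> obj (mod_cat (full_subcategory C S))"
proof -
  interpret S: preadditive "full_subcategory C S"
    by (rule preadditive_full_subcategory) unfold_locales
  note hf = hom_functor_simps[OF j, where C = C]
  show ?thesis
  proof (rule S.mod_cat_objI; unfold full_subcategory_simps full_subcategory_ab_simps Int_iff; (elim conjE)?)
    fix X assume X: "X \<in> obj C"
    show "comm_group (fob (hom_functor j C Y) X)"
      unfolding hom_functor_def using hom_group[OF X Y] inj_on_subset[OF j]
      by (simp add: comm_group_image_group)
    show "fmor (hom_functor j C Y) X X (ident C X) x = x" if "x \<in> carrier (fob (hom_functor j C Y) X)" for x
      using that X Y by (auto simp: hf comp_ident_right)
    fix X' assume X': "X' \<in> obj C"
    show "fmor (hom_functor j C Y) X X' f \<in> hom (fob (hom_functor j C Y) X) (fob (hom_functor j C Y) X')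
        \<and> fmor (hom_functor j C Y) X X' f \<in> extensional (carrier (fob (hom_functor j C Y) X))"
      if f: "f \<in> arr C X' X" for f
    proof
      show "fmor (hom_functor j C Y) X X' f \<in> hom (fob (hom_functor j C Y) X) (fob (hom_functor j C Y) X')"
        using f X X' Y by (intro homI) (auto simp: hf comp_arr hadd_arr comp_hadd_left)
    qed (simp add: hf)
    show "fmor (hom_functor j C Y) X X' (hadd C X' X f g) x
        = fmor (hom_functor j C Y) X X' f x \<otimes>\<^bsub>fob (hom_functor j C Y) X'\<^esub> fmor (hom_functor j C Y) X X' g x"
      if "f \<in> arr C X' X" "g \<in> arr C X' X" "x \<in> carrier (fob (hom_functor j C Y) X)" for f g x
      using that X X' Y by (auto simp: hf comp_arr comp_hadd_right)
    show "fmor (hom_functor j C Y) X Z (cmp C Z X' X f g) x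
        = fmor (hom_functor j C Y) X' Z g (fmor (hom_functor j C Y) X X' f x)"
      if "Z \<in> obj C" "f \<in> arr C X' X" "g \<in> arr C Z X'" "x \<in> carrier (fob (hom_functor j C Y) X)" for Z f g x
      using that X X' Y by (auto simp: hf comp_arr comp_assoc)
  qed
qed

lemma restricted_yoneda_simps:
  assumes "inj j"
  shows "fob (restricted_yoneda j C A) = hom_functor j C"
    "\<lbrakk>X \<in> obj A; u \<in> arr C X Y\<rbrakk> \<Longrightarrow> fmor (restricted_yoneda j C A) Y Y' h X (j u) = j (cmp C X Y Y' h u)"
    "X \<in> obj A \<Longrightarrow> fmor (restricted_yoneda j C A) Y Y' h X \<in> extensional (j ` arr C X Y)"
    "fmor (restricted_yoneda j C A) Y Y' h \<in> extensional (obj A)"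
  using inj_on_subset[OF assms] by (simp_all add: restricted_yoneda_def)

lemma (in preadditive) is_functor_restricted_yoneda:
  fixes j :: "'m \<Rightarrow> 'g"
  assumes j: "inj j" and cat: "category (mod_cat (full_subcategory C S) :: (('o, 'm, 'g) cat_module, 'o \<Rightarrow> 'g \<Rightarrow> 'g) cat)"
  shows "is_functor C (mod_cat (full_subcategory C S)) (restricted_yoneda j C (full_subcategory C S))"
    (is "is_functor C ?D ?Y")
proof -
  note hf = hom_functor_simps[OF j, where C = C] and ry = restricted_yoneda_simps[OF j, where C = C and A = "full_subcategory C S"]
  have Yarr: "fmor ?Y Y Y' h \<in> arr ?D (fob ?Y Y) (fob ?Y Y')"
    if Y: "Y \<in> obj C" "Y' \<in> obj C" "h \<in> arr C Y Y'" for Y Y' h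
    unfolding ry(1)
  proof (rule mod_cat_arrI[OF hom_functor_mod[OF j Y(1)] hom_functor_mod[OF j Y(2)]])
    show "fmor ?Y Y Y' h \<in> extensional (obj (full_subcategory C S))" by (rule ry(4))
    fix X assume X: "X \<in> obj (full_subcategory C S)"
    have "fmor ?Y Y Y' h X \<in> hom (fob (hom_functor j C Y) X) (fob (hom_functor j C Y') X)"
      using Y X by (intro homI) (auto simp: hf ry comp_arr hadd_arr comp_hadd_right)
    then show "fmor ?Y Y Y' h X \<in> hom (fob (hom_functor j C Y) X) (fob (hom_functor j C Y') X)
        \<inter> extensional (carrier (fob (hom_functor j C Y) X))"
      using ry(3)[OF X] by (simp add: hf)
    fix X' f x assume "X' \<in> obj (full_subcategory C S)" "f \<in> arr (full_subcategory C S) X' X"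
      "x \<in> carrier (fob (hom_functor j C Y) X)"
    then show "fmor ?Y Y Y' h X' (fmor (hom_functor j C Y) X X' f x)
       = fmor (hom_functor j C Y') X X' f (fmor ?Y Y Y' h X x)"
      using X Y by (auto simp: hf ry comp_arr comp_assoc)
  qed
  have eqI: "\<eta> = \<theta>" if "\<eta> \<in> extensional (obj (full_subcategory C S))" "\<theta> \<in> extensional (obj (full_subcategory C S))"
    "\<And>X. X \<in> obj (full_subcategory C S) \<Longrightarrow> \<eta> X \<in> extensional (j ` arr C X Y)"
    "\<And>X. X \<in> obj (full_subcategory C S) \<Longrightarrow> \<theta> X \<in> extensional (j ` arr C X Y)"
    "\<And>X u. X \<in> obj (full_subcategory C S) \<Longrightarrow> u \<in> arr C X Y \<Longrightarrow> \<eta> X (j u) = \<theta> X (j u)"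
    for \<eta> \<theta> :: "'o \<Rightarrow> 'g \<Rightarrow> 'g" and Y
    using that(1,2)
  proof (rule extensionalityI)
    fix X assume X: "X \<in> obj (full_subcategory C S)"
    show "\<eta> X = \<theta> X"
      using that(3,4)[OF X] by (rule extensionalityI) (use that(5)[OF X] in auto)
  qed
  show ?thesis
    unfolding is_functor_def
  proof (intro conjI ballI)
    show "category C" by unfold_locales
    show "category ?D" by (rule cat)
    fix X assume X: "X \<in> obj C"
    show "fob ?Y X \<in> obj ?D"
      using hom_functor_mod[OF j X] by (simp add: ry)
    show "fmor ?Y X X (ident C X) = ident ?D (fob ?Y X)"
      by (rule eqI[of _ _ X]) (use X in \<open>auto simp: ry ry(4)[unfolded full_subcategory_simps] hf mod_cat_simps comp_ident_left\<close>)
    fix Y assume Y: "Y \<in> obj C"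
    show "fmor ?Y X Y f \<in> arr ?D (fob ?Y X) (fob ?Y Y)" if "f \<in> arr C X Y" for f
      using Yarr[OF X Y that] .
    show "fmor ?Y X Z (cmp C X Y Z g f) = cmp ?D (fob ?Y X) (fob ?Y Y) (fob ?Y Z) (fmor ?Y Y Z g) (fmor ?Y X Y f)"
      if "Z \<in> obj C" "f \<in> arr C X Y" "g \<in> arr C Y Z" for Z f g
      by (rule eqI[of _ _ X])
        (use X Y that in \<open>auto simp: ry ry(4)[unfolded full_subcategory_simps] hf mod_cat_simps compose_def comp_arr comp_assoc\<close>)
  qed
qed

section \<open>The category of possibly big controlled modules\<close>

lemma free_module_simps [simp]:
  "x \<oplus>\<^bsub>free_module R A\<^esub> y = (\<lambda>a. x a \<oplus>\<^bsub>R\<^esub> y a)" "r \<odot>\<^bsub>free_module R A\<^esub> x = (\<lambda>a. r \<otimes>\<^bsub>R\<^esub> x a)"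
  "\<zero>\<^bsub>free_module R A\<^esub> = (\<lambda>a. \<zero>\<^bsub>R\<^esub>)"
  by (simp_all add: free_module_def)

lemma free_module_carrier_iff:
  "x \<in> carrier (free_module R A) \<longleftrightarrow>
    (\<forall>a. x a \<in> carrier R) \<and> finite {a. x a \<noteq> \<zero>\<^bsub>R\<^esub>} \<and> {a. x a \<noteq> \<zero>\<^bsub>R\<^esub>} \<subseteq> A"
  by (simp add: free_module_def)

lemma module_homs_freeD:
  assumes "\<phi> \<in> module_homs R (free_module R A) (free_module R B)"
  shows "x \<in> carrier (free_module R A) \<Longrightarrow> \<phi> x \<in> carrier (free_module R B)"
    "\<phi> \<in> extensional (carrier (free_module R A))"
    "\<lbrakk>x \<in> carrier (free_module R A); y \<in> carrier (free_module R A)\<rbrakk>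
      \<Longrightarrow> \<phi> (\<lambda>a. x a \<oplus>\<^bsub>R\<^esub> y a) = (\<lambda>b. \<phi> x b \<oplus>\<^bsub>R\<^esub> \<phi> y b)"
    "\<lbrakk>r \<in> carrier R; x \<in> carrier (free_module R A)\<rbrakk>
      \<Longrightarrow> \<phi> (\<lambda>a. r \<otimes>\<^bsub>R\<^esub> x a) = (\<lambda>b. r \<otimes>\<^bsub>R\<^esub> \<phi> x b)"
  using assms by (auto simp: module_homs_def PiE_def)

lemma module_homs_freeI:
  assumes "\<phi> \<in> extensional (carrier (free_module R A))"
    "\<And>x. x \<in> carrier (free_module R A) \<Longrightarrow> \<phi> x \<in> carrier (free_module R B)"
    "\<And>x y. \<lbrakk>x \<in> carrier (free_module R A); y \<in> carrier (free_module R A)\<rbrakk>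
      \<Longrightarrow> \<phi> (\<lambda>a. x a \<oplus>\<^bsub>R\<^esub> y a) = (\<lambda>b. \<phi> x b \<oplus>\<^bsub>R\<^esub> \<phi> y b)"
    "\<And>r x. \<lbrakk>r \<in> carrier R; x \<in> carrier (free_module R A)\<rbrakk>
      \<Longrightarrow> \<phi> (\<lambda>a. r \<otimes>\<^bsub>R\<^esub> x a) = (\<lambda>b. r \<otimes>\<^bsub>R\<^esub> \<phi> x b)"
  shows "\<phi> \<in> module_homs R (free_module R A) (free_module R B)"
  using assms by (auto simp: module_homs_def PiE_def)

context ring
begin

lemma free_module_zero_closed: "(\<lambda>a. \<zero>) \<in> carrier (free_module R A)"
  by (simp add: free_module_carrier_iff)

lemma free_module_add_closed:
  assumes "x \<in> carrier (free_module R A)" "y \<in> carrier (free_module R A)"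
  shows "(\<lambda>a. x a \<oplus> y a) \<in> carrier (free_module R A)"
proof -
  have "{a. x a \<oplus> y a \<noteq> \<zero>} \<subseteq> {a. x a \<noteq> \<zero>} \<union> {a. y a \<noteq> \<zero>}"
    by auto
  then show ?thesis
    using assms by (auto simp: free_module_carrier_iff intro: finite_subset)
qed

lemma free_module_smult_closed:
  assumes "r \<in> carrier R" "x \<in> carrier (free_module R A)"
  shows "(\<lambda>a. r \<otimes> x a) \<in> carrier (free_module R A)"
proof -
  have "{a. r \<otimes> x a \<noteq> \<zero>} \<subseteq> {a. x a \<noteq> \<zero>}"
    using assms(1) by auto
  then show ?thesis
    using assms by (auto simp: free_module_carrier_iff intro: finite_subset)
qed

lemma free_module_minus_closed:
  assumes "x \<in> carrier (free_module R A)"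
  shows "(\<lambda>a. \<ominus> x a) \<in> carrier (free_module R A)"
proof -
  have "{a. \<ominus> x a \<noteq> \<zero>} \<subseteq> {a. x a \<noteq> \<zero>}"
    by auto
  then show ?thesis
    using assms by (auto simp: free_module_carrier_iff intro: finite_subset)
qed

lemma basis_elt_closed: "a \<in> A \<Longrightarrow> basis_elt R a \<in> carrier (free_module R A)"
  by (auto simp: free_module_carrier_iff basis_elt_def intro: finite_subset[of _ "{a}"])

text \<open>
  A homomorphism is determined by the basis. With this, the control condition, which speaks of
  basis elements only, bounds the images of all elements, as the composition of
  controlled homomorphisms requires.
\<close>

lemma module_hom_free_carrier:
  assumes \<phi>: "\<phi> \<in> module_homs R (free_module R A) (free_module R B)"
    and basis: "\<And>a. a \<in> S \<Longrightarrow> \<phi> (basis_elt R a) \<in> carrier (free_module R B')"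
    and x: "x \<in> carrier (free_module R S)" and S: "S \<subseteq> A"
  shows "\<phi> x \<in> carrier (free_module R B')"
proof -
  have "\<phi> x \<in> carrier (free_module R B')"
    if "finite F" "{a. x a \<noteq> \<zero>} \<subseteq> F" "x \<in> carrier (free_module R S)" for F x
    using that
  proof (induction F arbitrary: x rule: finite_induct)
    case empty
    then have x: "x = (\<lambda>a. \<zero>)" by auto
    have "\<phi> x = \<phi> (\<lambda>a. \<zero> \<otimes> x a)" by (simp add: x)
    also have "\<dots> = (\<lambda>b. \<zero> \<otimes> \<phi> x b)"
      by (rule module_homs_freeD(4)[OF \<phi>]) (simp_all add: x free_module_zero_closed)
    also have "\<dots> = (\<lambda>b. \<zero>)"
      using module_homs_freeD(1)[OF \<phi>, of x] by (simp add: x free_module_zero_closed free_module_carrier_iff)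
    finally show ?case
      by (simp add: free_module_zero_closed)
  next
    case (insert a F)
    show ?case
    proof (cases "x a = \<zero>")
      case True
      then show ?thesis
        using insert by blast
    next
      case False
      define y where "y = (\<lambda>b. if b = a then \<zero> else x b)"
      have aS: "a \<in> S"
        using False insert.prems(2) by (auto simp: free_module_carrier_iff)
      have xc: "x b \<in> carrier R" for b
        using insert.prems(2) by (simp add: free_module_carrier_iff)
      have "{b. y b \<noteq> \<zero>} \<subseteq> {b. x b \<noteq> \<zero>}"
        by (auto simp: y_def)
      then have y: "y \<in> carrier (free_module R S)"
        using insert.prems(2) by (auto simp: free_module_carrier_iff y_def intro: finite_subset)
      have "{b. y b \<noteq> \<zero>} \<subseteq> F"
        using insert.prems(1) by (auto simp: y_def)
      then have \<phi>y: "\<phi> y \<in> carrier (free_module R B')"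
        using insert.IH y by blast
      have "x = (\<lambda>b. y b \<oplus> x a \<otimes> basis_elt R a b)"
        using xc by (auto simp: y_def basis_elt_def)
      then have "\<phi> x = \<phi> (\<lambda>b. y b \<oplus> x a \<otimes> basis_elt R a b)" by simp
      also have "\<dots> = (\<lambda>b. \<phi> y b \<oplus> \<phi> (\<lambda>b. x a \<otimes> basis_elt R a b) b)"
        using y S aS xc by (intro module_homs_freeD(3)[OF \<phi>] free_module_smult_closed basis_elt_closed)
          (auto dest: subsetD[OF free_module_carrier_mono])
      also have "\<dots> = (\<lambda>b. \<phi> y b \<oplus> x a \<otimes> \<phi> (basis_elt R a) b)"
        using S aS xc by (subst module_homs_freeD(4)[OF \<phi>]) (auto intro: basis_elt_closed)
      finally show ?thesis
        using free_module_add_closed[OF \<phi>y free_module_smult_closed[OF xc basis[OF aS]]] by simp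
    qed
  qed
  then show ?thesis
    using x by (auto simp: free_module_carrier_iff)
qed

lemma big_controlled_cat_simps:
  "X \<in> obj (big_controlled_cat R T) \<longleftrightarrow> snd X \<in> fst X \<rightarrow>\<^sub>E topspace T"
  "\<phi> \<in> arr (big_controlled_cat R T) X Y \<longleftrightarrow>
    \<phi> \<in> module_homs R (free_module R (fst X)) (free_module R (fst Y)) \<and> is_controlled R T X Y \<phi>"
  "ident (big_controlled_cat R T) X = (\<lambda>x \<in> carrier (free_module R (fst X)). x)"
  "cmp (big_controlled_cat R T) X Y Z \<psi> \<phi> = compose (carrier (free_module R (fst X))) \<psi> \<phi>"
  "hadd (big_controlled_cat R T) X Y \<phi> \<psi> = (\<lambda>x \<in> carrier (free_module R (fst X)). \<lambda>b. \<phi> x b \<oplus> \<psi> x b)"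
  "hzero (big_controlled_cat R T) X Y = (\<lambda>x \<in> carrier (free_module R (fst X)). \<lambda>b. \<zero>)"
  by (auto simp: big_controlled_cat_def split_beta)

lemma is_controlled_iff':
  "is_controlled R T X Y \<phi> \<longleftrightarrow>
    (\<forall>\<epsilon> \<in> freudenthal_ends T. \<forall>K. compactin T K \<longrightarrow>
      (\<exists>L. compactin T L \<and> (\<forall>a \<in> fst X. snd X a \<in> \<epsilon> L \<longrightarrow>
         \<phi> (basis_elt R a) \<in> carrier (free_module R {b \<in> fst Y. snd Y b \<in> \<epsilon> K}))))"
  using is_controlled_iff[of R T "fst X" "snd X" "fst Y" "snd Y"] by simp

lemma controlled_ident: "ident (big_controlled_cat R T) X \<in> arr (big_controlled_cat R T) X X"
proof -
  have "is_controlled R T X X (\<lambda>x \<in> carrier (free_module R (fst X)). x)"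
    unfolding is_controlled_iff'
  proof (intro ballI allI impI)
    fix \<epsilon> K assume "compactin T K"
    then show "\<exists>L. compactin T L \<and> (\<forall>a \<in> fst X. snd X a \<in> \<epsilon> L \<longrightarrow>
         (\<lambda>x \<in> carrier (free_module R (fst X)). x) (basis_elt R a)
           \<in> carrier (free_module R {b \<in> fst X. snd X b \<in> \<epsilon> K}))"
      by (intro exI[of _ K]) (auto simp: basis_elt_closed)
  qed
  then show ?thesis
    unfolding big_controlled_cat_simps
    by (auto intro!: module_homs_freeI simp: free_module_add_closed free_module_smult_closed)
qed

lemma controlled_comp:
  assumes \<phi>: "\<phi> \<in> arr (big_controlled_cat R T) X Y" and \<psi>: "\<psi> \<in> arr (big_controlled_cat R T) Y Z"
  shows "compose (carrier (free_module R (fst X))) \<psi> \<phi> \<in> arr (big_controlled_cat R T) X Z"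
    (is "?\<rho> \<in> _")
proof -
  have h\<phi>: "\<phi> \<in> module_homs R (free_module R (fst X)) (free_module R (fst Y))"
    and h\<psi>: "\<psi> \<in> module_homs R (free_module R (fst Y)) (free_module R (fst Z))"
    and c\<phi>: "is_controlled R T X Y \<phi>" and c\<psi>: "is_controlled R T Y Z \<psi>"
    using \<phi> \<psi> by (auto simp: big_controlled_cat_simps)
  note d\<phi> = module_homs_freeD[OF h\<phi>] and d\<psi> = module_homs_freeD[OF h\<psi>]
  have "?\<rho> \<in> module_homs R (free_module R (fst X)) (free_module R (fst Z))"
    by (rule module_homs_freeI)
      (simp_all add: compose_def free_module_add_closed free_module_smult_closed d\<phi>(1,3,4) d\<psi>(1,3,4))
  moreover have "is_controlled R T X Z ?\<rho>"
    unfolding is_controlled_iff'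
  proof (intro ballI allI impI)
    fix \<epsilon> K assume \<epsilon>: "\<epsilon> \<in> freudenthal_ends T" and K: "compactin T K"
    obtain L where L: "compactin T L" "\<forall>b \<in> fst Y. snd Y b \<in> \<epsilon> L \<longrightarrow>
         \<psi> (basis_elt R b) \<in> carrier (free_module R {c \<in> fst Z. snd Z c \<in> \<epsilon> K})"
      using c\<psi> \<epsilon> K unfolding is_controlled_iff' by blast
    obtain M where M: "compactin T M" "\<forall>a \<in> fst X. snd X a \<in> \<epsilon> M \<longrightarrow>
         \<phi> (basis_elt R a) \<in> carrier (free_module R {b \<in> fst Y. snd Y b \<in> \<epsilon> L})"
      using c\<phi> \<epsilon> L(1) unfolding is_controlled_iff' by blast
    have "?\<rho> (basis_elt R a) \<in> carrier (free_module R {c \<in> fst Z. snd Z c \<in> \<epsilon> K})"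
      if a: "a \<in> fst X" "snd X a \<in> \<epsilon> M" for a
      using module_hom_free_carrier[OF h\<psi>, of "{b \<in> fst Y. snd Y b \<in> \<epsilon> L}"
          "{c \<in> fst Z. snd Z c \<in> \<epsilon> K}" "\<phi> (basis_elt R a)"] L(2) M(2) a basis_elt_closed[OF a(1)]
      by (auto simp: compose_def)
    then show "\<exists>M. compactin T M \<and> (\<forall>a \<in> fst X. snd X a \<in> \<epsilon> M \<longrightarrow>
         ?\<rho> (basis_elt R a) \<in> carrier (free_module R {c \<in> fst Z. snd Z c \<in> \<epsilon> K}))"
      using M(1) by blast
  qed
  ultimately show ?thesis
    by (simp add: big_controlled_cat_simps)
qed

lemma category_big_controlled_cat:
  "category (big_controlled_cat R T :: (('c, 't) controlled, ('c \<Rightarrow> 'a) \<Rightarrow> ('c \<Rightarrow> 'a)) ab_cat)"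
proof
  fix X Y :: "('c, 't) controlled" and \<phi> :: "('c \<Rightarrow> 'a) \<Rightarrow> ('c \<Rightarrow> 'a)"
  assume "\<phi> \<in> arr (big_controlled_cat R T) X Y"
  then have "\<phi> \<in> extensional (carrier (free_module R (fst X)))"
    "\<And>x. x \<in> carrier (free_module R (fst X)) \<Longrightarrow> \<phi> x \<in> carrier (free_module R (fst Y))"
    using module_homs_freeD(1,2) by (auto simp: big_controlled_cat_simps)
  then show "cmp (big_controlled_cat R T) X X Y \<phi> (ident (big_controlled_cat R T) X) = \<phi>"
    "cmp (big_controlled_cat R T) X Y Y (ident (big_controlled_cat R T) Y) \<phi> = \<phi>"
    by (auto simp: big_controlled_cat_simps compose_def fun_eq_iff extensional_def)
next
  fix W X Y Z :: "('c, 't) controlled" and \<phi> \<psi> \<rho> :: "('c \<Rightarrow> 'a) \<Rightarrow> ('c \<Rightarrow> 'a)"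
  assume "\<phi> \<in> arr (big_controlled_cat R T) W X"
  then have "\<And>x. x \<in> carrier (free_module R (fst W)) \<Longrightarrow> \<phi> x \<in> carrier (free_module R (fst X))"
    using module_homs_freeD(1) by (auto simp: big_controlled_cat_simps)
  then show "cmp (big_controlled_cat R T) W Y Z \<rho> (cmp (big_controlled_cat R T) W X Y \<psi> \<phi>)
    = cmp (big_controlled_cat R T) W X Z (cmp (big_controlled_cat R T) X Y Z \<rho> \<psi>) \<phi>"
    by (auto simp: big_controlled_cat_simps(4) compose_def fun_eq_iff)
qed (use controlled_ident controlled_comp in \<open>auto simp: big_controlled_cat_simps(4)\<close>)

lemma controlled_add:
  assumes \<phi>: "\<phi> \<in> arr (big_controlled_cat R T) X Y" and \<psi>: "\<psi> \<in> arr (big_controlled_cat R T) X Y"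
  shows "hadd (big_controlled_cat R T) X Y \<phi> \<psi> \<in> arr (big_controlled_cat R T) X Y"
proof -
  let ?\<rho> = "\<lambda>x \<in> carrier (free_module R (fst X)). \<lambda>b. \<phi> x b \<oplus> \<psi> x b"
  have h\<phi>: "\<phi> \<in> module_homs R (free_module R (fst X)) (free_module R (fst Y))"
    and h\<psi>: "\<psi> \<in> module_homs R (free_module R (fst X)) (free_module R (fst Y))"
    and c\<phi>: "is_controlled R T X Y \<phi>" and c\<psi>: "is_controlled R T X Y \<psi>"
    using \<phi> \<psi> by (auto simp: big_controlled_cat_simps)
  note d\<phi> = module_homs_freeD[OF h\<phi>] and d\<psi> = module_homs_freeD[OF h\<psi>]
  have R\<phi>: "\<phi> x b \<in> carrier R" "\<psi> x b \<in> carrier R" if "x \<in> carrier (free_module R (fst X))" for x b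
    using d\<phi>(1)[OF that] d\<psi>(1)[OF that] by (simp_all add: free_module_carrier_iff)
  have "?\<rho> \<in> module_homs R (free_module R (fst X)) (free_module R (fst Y))"
    by (rule module_homs_freeI)
      (simp_all add: free_module_add_closed free_module_smult_closed d\<phi>(1,3,4) d\<psi>(1,3,4) R\<phi> a_ac r_distr)
  moreover have "is_controlled R T X Y ?\<rho>"
    unfolding is_controlled_iff'
  proof (intro ballI allI impI)
    fix \<epsilon> K assume \<epsilon>: "\<epsilon> \<in> freudenthal_ends T" and K: "compactin T K"
    obtain L where L: "compactin T L" "\<forall>a \<in> fst X. snd X a \<in> \<epsilon> L \<longrightarrow>
         \<phi> (basis_elt R a) \<in> carrier (free_module R {b \<in> fst Y. snd Y b \<in> \<epsilon> K})"
      using c\<phi> \<epsilon> K unfolding is_controlled_iff' by blast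
    obtain M where M: "compactin T M" "\<forall>a \<in> fst X. snd X a \<in> \<epsilon> M \<longrightarrow>
         \<psi> (basis_elt R a) \<in> carrier (free_module R {b \<in> fst Y. snd Y b \<in> \<epsilon> K})"
      using c\<psi> \<epsilon> K unfolding is_controlled_iff' by blast
    have LM: "compactin T (L \<union> M)"
      using L M by (simp add: compactin_Un)
    have "\<epsilon> (L \<union> M) \<subseteq> \<epsilon> L" "\<epsilon> (L \<union> M) \<subseteq> \<epsilon> M"
      using freudenthal_endsD(2)[OF \<epsilon> _ LM] L(1) M(1) by auto
    then have "?\<rho> (basis_elt R a) \<in> carrier (free_module R {b \<in> fst Y. snd Y b \<in> \<epsilon> K})"
      if "a \<in> fst X" "snd X a \<in> \<epsilon> (L \<union> M)" for a
      using that L(2) M(2) basis_elt_closed[OF that(1)] by (auto intro!: free_module_add_closed)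
    then show "\<exists>L. compactin T L \<and> (\<forall>a \<in> fst X. snd X a \<in> \<epsilon> L \<longrightarrow>
         ?\<rho> (basis_elt R a) \<in> carrier (free_module R {b \<in> fst Y. snd Y b \<in> \<epsilon> K}))"
      using LM by blast
  qed
  ultimately show ?thesis
    by (simp add: big_controlled_cat_simps)
qed

lemma controlled_zero: "hzero (big_controlled_cat R T) X Y \<in> arr (big_controlled_cat R T) X Y"
  unfolding big_controlled_cat_simps is_controlled_iff'
  by (auto intro!: module_homs_freeI
      simp: free_module_add_closed free_module_smult_closed free_module_zero_closed basis_elt_closed)

lemma controlled_minus:
  assumes \<phi>: "\<phi> \<in> arr (big_controlled_cat R T) X Y"
  shows "(\<lambda>x \<in> carrier (free_module R (fst X)). \<lambda>b. \<ominus> \<phi> x b) \<in> arr (big_controlled_cat R T) X Y"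
    (is "?\<rho> \<in> _")
proof -
  have h\<phi>: "\<phi> \<in> module_homs R (free_module R (fst X)) (free_module R (fst Y))"
    and c\<phi>: "is_controlled R T X Y \<phi>"
    using \<phi> by (auto simp: big_controlled_cat_simps)
  note d\<phi> = module_homs_freeD[OF h\<phi>]
  have R\<phi>: "\<phi> x b \<in> carrier R" if "x \<in> carrier (free_module R (fst X))" for x b
    using d\<phi>(1)[OF that] by (simp add: free_module_carrier_iff)
  have "?\<rho> \<in> module_homs R (free_module R (fst X)) (free_module R (fst Y))"
    by (rule module_homs_freeI)
      (simp_all add: free_module_add_closed free_module_smult_closed free_module_minus_closed
        d\<phi>(1,3,4) R\<phi> minus_add r_minus)
  moreover have "is_controlled R T X Y ?\<rho>"
    unfolding is_controlled_iff'
  proof (intro ballI allI impI)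
    fix \<epsilon> K assume \<epsilon>: "\<epsilon> \<in> freudenthal_ends T" and K: "compactin T K"
    obtain L where L: "compactin T L" "\<forall>a \<in> fst X. snd X a \<in> \<epsilon> L \<longrightarrow>
         \<phi> (basis_elt R a) \<in> carrier (free_module R {b \<in> fst Y. snd Y b \<in> \<epsilon> K})"
      using c\<phi> \<epsilon> K unfolding is_controlled_iff' by blast
    then show "\<exists>L. compactin T L \<and> (\<forall>a \<in> fst X. snd X a \<in> \<epsilon> L \<longrightarrow>
         ?\<rho> (basis_elt R a) \<in> carrier (free_module R {b \<in> fst Y. snd Y b \<in> \<epsilon> K}))"
      by (intro exI[of _ L]) (simp add: basis_elt_closed free_module_minus_closed)
  qed
  ultimately show ?thesis
    by (simp add: big_controlled_cat_simps)
qed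

lemma preadditive_big_controlled_cat:
  "preadditive (big_controlled_cat R T :: (('c, 't) controlled, ('c \<Rightarrow> 'a) \<Rightarrow> ('c \<Rightarrow> 'a)) ab_cat)"
proof (intro preadditive.intro preadditive_axioms.intro category_big_controlled_cat)
  fix X Y :: "('c, 't) controlled"
  let ?G = "hom_group (big_controlled_cat R T) X Y"
  have val: "\<phi> x b \<in> carrier R"
    if "\<phi> \<in> arr (big_controlled_cat R T) X Y" "x \<in> carrier (free_module R (fst X))" for \<phi> x b
    using module_homs_freeD(1) that by (fastforce simp: big_controlled_cat_simps free_module_carrier_iff)
  have ext: "\<phi> \<in> extensional (carrier (free_module R (fst X)))"
    if "\<phi> \<in> arr (big_controlled_cat R T) X Y" for \<phi>
    using module_homs_freeD(2) that by (auto simp: big_controlled_cat_simps)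
  show "comm_group ?G"
  proof (rule comm_groupI)
    show "\<one>\<^bsub>?G\<^esub> \<in> carrier ?G"
      by (simp add: hom_group_def controlled_zero)
    fix \<phi> assume \<phi>: "\<phi> \<in> carrier ?G"
    then have \<phi>': "\<phi> \<in> arr (big_controlled_cat R T) X Y" by (simp add: hom_group_def)
    show "\<one>\<^bsub>?G\<^esub> \<otimes>\<^bsub>?G\<^esub> \<phi> = \<phi>"
      using val[OF \<phi>'] ext[OF \<phi>']
      by (auto simp: hom_group_def big_controlled_cat_simps(5,6) fun_eq_iff extensional_def)
    show "\<exists>\<psi>\<in>carrier ?G. \<psi> \<otimes>\<^bsub>?G\<^esub> \<phi> = \<one>\<^bsub>?G\<^esub>"
      using controlled_minus[OF \<phi>'] val[OF \<phi>']
      by (intro bexI[of _ "\<lambda>x \<in> carrier (free_module R (fst X)). \<lambda>b. \<ominus> \<phi> x b"])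
        (auto simp: hom_group_def big_controlled_cat_simps(5,6) l_neg fun_eq_iff)
    fix \<psi> assume "\<psi> \<in> carrier ?G"
    then have \<psi>': "\<psi> \<in> arr (big_controlled_cat R T) X Y" by (simp add: hom_group_def)
    show "\<phi> \<otimes>\<^bsub>?G\<^esub> \<psi> \<in> carrier ?G"
      using controlled_add[OF \<phi>' \<psi>'] by (simp add: hom_group_def)
    show "\<phi> \<otimes>\<^bsub>?G\<^esub> \<psi> = \<psi> \<otimes>\<^bsub>?G\<^esub> \<phi>"
      using val[OF \<phi>'] val[OF \<psi>'] by (auto simp: hom_group_def big_controlled_cat_simps(5) a_comm fun_eq_iff)
    fix \<rho> assume "\<rho> \<in> carrier ?G"
    then have \<rho>': "\<rho> \<in> arr (big_controlled_cat R T) X Y" by (simp add: hom_group_def)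
    show "\<phi> \<otimes>\<^bsub>?G\<^esub> \<psi> \<otimes>\<^bsub>?G\<^esub> \<rho> = \<phi> \<otimes>\<^bsub>?G\<^esub> (\<psi> \<otimes>\<^bsub>?G\<^esub> \<rho>)"
      using val[OF \<phi>'] val[OF \<psi>'] val[OF \<rho>']
      by (auto simp: hom_group_def big_controlled_cat_simps(5) a_assoc fun_eq_iff)
  qed
next
  fix X Y Z :: "('c, 't) controlled" and \<phi> \<phi>' \<psi> :: "('c \<Rightarrow> 'a) \<Rightarrow> ('c \<Rightarrow> 'a)"
  assume "\<phi> \<in> arr (big_controlled_cat R T) X Y" "\<phi>' \<in> arr (big_controlled_cat R T) X Y"
    "\<psi> \<in> arr (big_controlled_cat R T) Y Z"
  then have "\<And>x. x \<in> carrier (free_module R (fst X)) \<Longrightarrow> \<phi> x \<in> carrier (free_module R (fst Y))"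
    "\<And>x. x \<in> carrier (free_module R (fst X)) \<Longrightarrow> \<phi>' x \<in> carrier (free_module R (fst Y))"
    "\<And>x y. \<lbrakk>x \<in> carrier (free_module R (fst Y)); y \<in> carrier (free_module R (fst Y))\<rbrakk>
      \<Longrightarrow> \<psi> (\<lambda>a. x a \<oplus> y a) = (\<lambda>b. \<psi> x b \<oplus> \<psi> y b)"
    unfolding big_controlled_cat_simps(2) by (blast dest: module_homs_freeD(1,3))+
  then show "cmp (big_controlled_cat R T) X Y Z \<psi> (hadd (big_controlled_cat R T) X Y \<phi> \<phi>')
    = hadd (big_controlled_cat R T) X Z (cmp (big_controlled_cat R T) X Y Z \<psi> \<phi>)
       (cmp (big_controlled_cat R T) X Y Z \<psi> \<phi>')"
    by (auto simp: big_controlled_cat_simps(4,5) compose_def fun_eq_iff)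
next
  fix X Y Z :: "('c, 't) controlled" and \<phi> \<psi> \<psi>' :: "('c \<Rightarrow> 'a) \<Rightarrow> ('c \<Rightarrow> 'a)"
  assume "\<phi> \<in> arr (big_controlled_cat R T) X Y"
  then have "\<And>x. x \<in> carrier (free_module R (fst X)) \<Longrightarrow> \<phi> x \<in> carrier (free_module R (fst Y))"
    using module_homs_freeD(1) by (auto simp: big_controlled_cat_simps)
  then show "cmp (big_controlled_cat R T) X Y Z (hadd (big_controlled_cat R T) Y Z \<psi> \<psi>') \<phi>
    = hadd (big_controlled_cat R T) X Z (cmp (big_controlled_cat R T) X Y Z \<psi> \<phi>)
       (cmp (big_controlled_cat R T) X Y Z \<psi>' \<phi>)"
    by (auto simp: big_controlled_cat_simps(4,5) compose_def fun_eq_iff)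
qed

end

section \<open>Non-big subobjects of big modules\<close>

definition subobject :: "('a, 't) controlled \<Rightarrow> 'a set \<Rightarrow> ('a, 't) controlled" where
  "subobject X B = (B, restrict (snd X) B)"

definition hom_support ::
  "('r, 'x) ring_scheme \<Rightarrow> ('a, 't) controlled \<Rightarrow> (('a \<Rightarrow> 'r) \<Rightarrow> ('a \<Rightarrow> 'r)) \<Rightarrow> 'a set" where
  "hom_support R Z \<phi> = {a. \<exists>c \<in> fst Z. \<phi> (basis_elt R c) a \<noteq> \<zero>\<^bsub>R\<^esub>}"

lemma subobject_simps [simp]:
  "fst (subobject X B) = B" "snd (subobject X B) = restrict (snd X) B"
  by (simp_all add: subobject_def)

text \<open>
  The object part of change of tree. It is named separately because its type, unlike that of
  the functor, does not mention the coefficients.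
\<close>

definition push_control :: "('t \<Rightarrow> 'u) \<Rightarrow> ('a, 't) controlled \<Rightarrow> ('a, 'u) controlled" where
  "push_control f X = (fst X, compose (fst X) f (snd X))"

lemma push_control_simps [simp]:
  "fst (push_control f X) = fst X" "snd (push_control f X) = compose (fst X) f (snd X)"
  by (simp_all add: push_control_def)

lemma change_of_tree_simps [simp]:
  "fob (change_of_tree f) = push_control f" "fmor (change_of_tree f) X Y \<phi> = \<phi>"
  by (auto simp: change_of_tree_def push_control_def)

lemma push_control_subobject:
  "B \<subseteq> fst X \<Longrightarrow> push_control f (subobject X B) = subobject (push_control f X) B"
  by (auto simp: prod_eq_iff compose_def fun_eq_iff)

context ring
begin

lemma controlled_cat_simps:
  "arr (controlled_cat R T) = arr (big_controlled_cat R T)"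
  "ident (controlled_cat R T) = ident (big_controlled_cat R T)"
  "cmp (controlled_cat R T) = cmp (big_controlled_cat R T)"
  "hadd (controlled_cat R T) = hadd (big_controlled_cat R T)"
  by (simp_all add: controlled_cat_def)

lemma controlled_cat_obj:
  assumes "is_tree T"
  shows "X \<in> obj (controlled_cat R T) \<longleftrightarrow>
    X \<in> obj (big_controlled_cat R T) \<and> (\<forall>K. compactin T K \<longrightarrow> finite {a \<in> fst X. snd X a \<in> K})"
  using proper_map_discrete_iff[OF is_treeD(1,3)[OF assms], of "snd X" "fst X"]
  by (auto simp: controlled_cat_def big_controlled_cat_simps split_beta PiE_def)

lemma controlled_cat_obj_big: "X \<in> obj (controlled_cat R T) \<Longrightarrow> X \<in> obj (big_controlled_cat R T)"
  by (simp add: controlled_cat_def)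

lemma subobject_obj:
  "X \<in> obj (big_controlled_cat R T) \<Longrightarrow> B \<subseteq> fst X \<Longrightarrow> subobject X B \<in> obj (big_controlled_cat R T)"
  by (auto simp: big_controlled_cat_simps PiE_def Pi_iff)

text \<open>
  Since elements of free modules vanish off the basis, factoring through a subobject
  does not change the underlying function: the hom set into a subobject is a subset of the hom set into \<open>X\<close>.
\<close>

lemma arr_subobject_iff:
  assumes B: "B \<subseteq> fst X"
  shows "\<phi> \<in> arr (big_controlled_cat R T) Z (subobject X B) \<longleftrightarrow>
    \<phi> \<in> arr (big_controlled_cat R T) Z X \<and> hom_support R Z \<phi> \<subseteq> B"
proof -
  have split: "x \<in> carrier (free_module R {b \<in> B. restrict (snd X) B b \<in> W}) \<longleftrightarrow>
      x \<in> carrier (free_module R {b \<in> fst X. snd X b \<in> W}) \<and> x \<in> carrier (free_module R B)" for x W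
    using B by (auto simp: free_module_carrier_iff)
  show ?thesis
  proof (intro iffI conjI)
    assume \<phi>: "\<phi> \<in> arr (big_controlled_cat R T) Z (subobject X B)"
    then have h: "\<phi> \<in> module_homs R (free_module R (fst Z)) (free_module R B)"
      and c: "is_controlled R T Z (subobject X B) \<phi>"
      by (simp_all add: big_controlled_cat_simps)
    show "hom_support R Z \<phi> \<subseteq> B"
      using module_homs_freeD(1)[OF h basis_elt_closed]
      by (fastforce simp: hom_support_def free_module_carrier_iff)
    have "\<phi> \<in> module_homs R (free_module R (fst Z)) (free_module R (fst X))"
      using module_homs_freeD[OF h] subsetD[OF free_module_carrier_mono[OF B, of R]]
      by (intro module_homs_freeI) auto
    moreover have "is_controlled R T Z X \<phi>"
      using c unfolding is_controlled_iff' subobject_simps split by blast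
    ultimately show "\<phi> \<in> arr (big_controlled_cat R T) Z X"
      by (simp add: big_controlled_cat_simps)
  next
    assume "\<phi> \<in> arr (big_controlled_cat R T) Z X \<and> hom_support R Z \<phi> \<subseteq> B"
    then have h: "\<phi> \<in> module_homs R (free_module R (fst Z)) (free_module R (fst X))"
      and c: "is_controlled R T Z X \<phi>" and s: "hom_support R Z \<phi> \<subseteq> B"
      by (simp_all add: big_controlled_cat_simps)
    have b: "\<phi> (basis_elt R a) \<in> carrier (free_module R B)" if "a \<in> fst Z" for a
      using module_homs_freeD(1)[OF h basis_elt_closed[OF that]] s that
      by (auto simp: free_module_carrier_iff hom_support_def)
    have "\<phi> \<in> module_homs R (free_module R (fst Z)) (free_module R B)"
      using module_homs_freeD(2,3,4)[OF h] module_hom_free_carrier[OF h b, where S = "fst Z"]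
      by (intro module_homs_freeI) auto
    moreover have "is_controlled R T Z (subobject X B) \<phi>"
      using c b unfolding is_controlled_iff' subobject_simps split by simp
    ultimately show "\<phi> \<in> arr (big_controlled_cat R T) Z (subobject X B)"
      by (simp add: big_controlled_cat_simps)
  qed
qed

lemma hom_support_subset:
  assumes "\<phi> \<in> arr (big_controlled_cat R T) Z X"
  shows "hom_support R Z \<phi> \<subseteq> fst X"
proof -
  have h: "\<phi> \<in> module_homs R (free_module R (fst Z)) (free_module R (fst X))"
    using assms by (simp add: big_controlled_cat_simps)
  show ?thesis
    using module_homs_freeD(1)[OF h basis_elt_closed]
    by (fastforce simp: hom_support_def free_module_carrier_iff)
qed

text \<open>
  As the free module on a subset is literally a submodule, the inclusion of a subobject is the
  identity function of the smaller module.
\<close>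

lemma inclusion_arr:
  assumes "B \<subseteq> B'" "B' \<subseteq> fst X"
  shows "ident (big_controlled_cat R T) (subobject X B) \<in>
      arr (big_controlled_cat R T) (subobject X B) (subobject X B')"
    "ident (big_controlled_cat R T) (subobject X B) \<in> arr (big_controlled_cat R T) (subobject X B) X"
  using controlled_ident[of T "subobject X B"] arr_subobject_iff[of B X] arr_subobject_iff[of B' X] assms
  by (meson order_trans)+

text \<open>
  With \<open>arr_subobject_iff\<close>: every morphism from a non-big module to a big one factors through a
  non-big subobject.
\<close>

lemma subobject_hom_support_obj:
  assumes T: "is_tree T" and Z: "Z \<in> obj (controlled_cat R T)" and X: "X \<in> obj (big_controlled_cat R T)"
    and \<phi>: "\<phi> \<in> arr (big_controlled_cat R T) Z X"
  shows "subobject X (hom_support R Z \<phi>) \<in> obj (controlled_cat R T)"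
proof -
  have h: "\<phi> \<in> module_homs R (free_module R (fst Z)) (free_module R (fst X))"
    and c: "is_controlled R T Z X \<phi>"
    using \<phi> by (simp_all add: big_controlled_cat_simps)
  have "finite {a \<in> hom_support R Z \<phi>. snd X a \<in> K}" if K: "compactin T K" for K
    unfolding hom_support_def mem_Collect_eq
  proof (rule proper_controlled_hom_image_proper[OF T _ _ _ _ K])
    show "snd Z \<in> fst Z \<rightarrow> topspace T"
      using Z by (simp add: controlled_cat_obj[OF T] big_controlled_cat_simps PiE_def)
    show "finite {c \<in> fst Z. snd Z c \<in> L}" if "compactin T L" for L
      using Z that by (simp add: controlled_cat_obj[OF T])
    show "is_controlled R T (fst Z, snd Z) (fst X, snd X) \<phi>"
      using c by simp
    show "\<phi> (basis_elt R c) \<in> carrier (free_module R (fst X))" if "c \<in> fst Z" for c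
      using module_homs_freeD(1)[OF h basis_elt_closed[OF that]] .
  qed
  moreover have "{a \<in> hom_support R Z \<phi>. restrict (snd X) (hom_support R Z \<phi>) a \<in> K}
      = {a \<in> hom_support R Z \<phi>. snd X a \<in> K}" for K
    by auto
  ultimately show ?thesis
    using subobject_obj[OF X hom_support_subset[OF \<phi>]]
    by (simp add: controlled_cat_obj[OF T])
qed

lemma subobject_Un_obj:
  assumes T: "is_tree T" and X: "X \<in> obj (big_controlled_cat R T)" and "B \<subseteq> fst X" "B' \<subseteq> fst X"
    and "subobject X B \<in> obj (controlled_cat R T)" "subobject X B' \<in> obj (controlled_cat R T)"
  shows "subobject X (B \<union> B') \<in> obj (controlled_cat R T)"
proof -
  have "{a \<in> B \<union> B'. restrict (snd X) (B \<union> B') a \<in> K} =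
     {a \<in> B. restrict (snd X) B a \<in> K} \<union> {a \<in> B'. restrict (snd X) B' a \<in> K}" for K
    by auto
  then show ?thesis
    using assms subobject_obj[OF X, of "B \<union> B'"] by (simp add: controlled_cat_obj[OF T])
qed

lemma hom_support_comp:
  assumes \<phi>: "\<phi> \<in> arr (big_controlled_cat R T) Z X" and g: "g \<in> arr (big_controlled_cat R T) Z' Z"
  shows "hom_support R Z' (cmp (big_controlled_cat R T) Z' Z X \<phi> g) \<subseteq> hom_support R Z \<phi>"
proof -
  have "\<phi> \<in> arr (big_controlled_cat R T) Z (subobject X (hom_support R Z \<phi>))"
    using arr_subobject_iff[OF hom_support_subset[OF \<phi>]] \<phi> by blast
  from controlled_comp[OF g this] show ?thesis
    using arr_subobject_iff[OF hom_support_subset[OF \<phi>]] by (simp add: big_controlled_cat_simps(4))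
qed

lemma hom_support_add:
  assumes \<phi>: "\<phi> \<in> arr (big_controlled_cat R T) Z X" and \<psi>: "\<psi> \<in> arr (big_controlled_cat R T) Z X"
  shows "hom_support R Z (hadd (big_controlled_cat R T) Z X \<phi> \<psi>) \<subseteq> hom_support R Z \<phi> \<union> hom_support R Z \<psi>"
proof -
  let ?B = "hom_support R Z \<phi> \<union> hom_support R Z \<psi>"
  have B: "?B \<subseteq> fst X"
    using hom_support_subset \<phi> \<psi> by blast
  have "\<phi> \<in> arr (big_controlled_cat R T) Z (subobject X ?B)"
    "\<psi> \<in> arr (big_controlled_cat R T) Z (subobject X ?B)"
    using \<phi> \<psi> by (simp_all add: arr_subobject_iff[OF B])
  from controlled_add[OF this] show ?thesis
    using arr_subobject_iff[OF B] by (simp add: big_controlled_cat_simps(5))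
qed

end

section \<open>Change of tree and the universal property\<close>

locale tree_change = ring R for R :: "('r, 'x) ring_scheme" (structure) +
  fixes T :: "'t topology" and T' :: "'u topology" and f :: "'t \<Rightarrow> 'u"
    and j :: "(('a \<Rightarrow> 'r) \<Rightarrow> ('a \<Rightarrow> 'r)) \<Rightarrow> 'g"
  assumes T: "is_tree T" and T': "is_tree T'"
    and cont: "continuous_map T T' f" and proper: "proper_map T T' f"
    and inj: "inj j"
begin

abbreviation "Cb \<equiv> big_controlled_cat R T :: (('a, 't) controlled, ('a \<Rightarrow> 'r) \<Rightarrow> ('a \<Rightarrow> 'r)) ab_cat"
abbreviation "Db \<equiv> big_controlled_cat R T' :: (('a, 'u) controlled, ('a \<Rightarrow> 'r) \<Rightarrow> ('a \<Rightarrow> 'r)) ab_cat"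
abbreviation "C \<equiv> controlled_cat R T :: (('a, 't) controlled, ('a \<Rightarrow> 'r) \<Rightarrow> ('a \<Rightarrow> 'r)) ab_cat"
abbreviation "D \<equiv> controlled_cat R T' :: (('a, 'u) controlled, ('a \<Rightarrow> 'r) \<Rightarrow> ('a \<Rightarrow> 'r)) ab_cat"
abbreviation "F \<equiv> push_control f :: ('a, 't) controlled \<Rightarrow> ('a, 'u) controlled"

sublocale Cb: preadditive Cb by (rule preadditive_big_controlled_cat)
sublocale Db: preadditive Db by (rule preadditive_big_controlled_cat)

lemma F_obj: "X \<in> obj Cb \<Longrightarrow> F X \<in> obj Db"
  using cont by (auto simp: big_controlled_cat_simps continuous_map_def compose_def)

lemma F_arr: "X \<in> obj Cb \<Longrightarrow> \<phi> \<in> arr Cb X Y \<Longrightarrow> \<phi> \<in> arr Db (F X) (F Y)"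
  using is_controlled_change_of_tree[OF T T' cont proper, of "snd X" "fst X" R "fst Y" "snd Y" \<phi>]
  by (auto simp: big_controlled_cat_simps push_control_def PiE_def)

text \<open>
  Images of compact sets under \<open>f\<close> and preimages of compact sets under \<open>f\<close> are compact,
  so that properness can be tested after composition with \<open>f\<close>.
\<close>

lemma F_obj_iff:
  assumes X: "X \<in> obj Cb"
  shows "F X \<in> obj D \<longleftrightarrow> X \<in> obj C"
proof -
  have \<alpha>: "snd X a \<in> topspace T" if "a \<in> fst X" for a
    using X that by (auto simp: big_controlled_cat_simps)
  have "(\<forall>K. compactin T' K \<longrightarrow> finite {a \<in> fst X. f (snd X a) \<in> K}) \<longleftrightarrow>
     (\<forall>K. compactin T K \<longrightarrow> finite {a \<in> fst X. snd X a \<in> K})" (is "?l \<longleftrightarrow> ?r")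
  proof (intro iffI allI impI)
    fix K assume l: ?l and "compactin T K"
    then have "finite {a \<in> fst X. f (snd X a) \<in> f ` K}"
      using image_compactin[OF _ cont] by blast
    then show "finite {a \<in> fst X. snd X a \<in> K}"
      by (rule rev_finite_subset) auto
  next
    fix K assume r: ?r and K: "compactin T' K"
    have "finite {a \<in> fst X. snd X a \<in> {x \<in> topspace T. f x \<in> K}}"
      using r compactin_proper_map_preimage[OF proper K] by blast
    then show "finite {a \<in> fst X. f (snd X a) \<in> K}"
      by (rule rev_finite_subset) (use \<alpha> in auto)
  qed
  moreover have "{a \<in> fst X. compose (fst X) f (snd X) a \<in> K} = {a \<in> fst X. f (snd X a) \<in> K}" for K
    by (auto simp: compose_def)
  ultimately show ?thesis
    using X F_obj[OF X] by (simp add: controlled_cat_obj[OF T] controlled_cat_obj[OF T'])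
qed

lemma F_subobject: "B \<subseteq> fst X \<Longrightarrow> F (subobject X B) = subobject (F X) B"
  by (rule push_control_subobject)

lemma F_ident: "ident Db (F X) = ident Cb X"
  by (simp add: big_controlled_cat_simps)

lemma is_functor_change_of_tree: "is_functor Cb Db (change_of_tree f)"
  unfolding is_functor_def
  using F_obj F_arr Cb.category_axioms Db.category_axioms by (simp add: big_controlled_cat_simps(3,4))

abbreviation "YC X \<equiv> hom_functor j Cb X"
abbreviation "YD X \<equiv> hom_functor j Db X"

lemma YC_mod: "X \<in> obj Cb \<Longrightarrow> YC X \<in> obj (mod_cat C)"
  using Cb.hom_functor_mod[OF inj] unfolding controlled_cat_def by blast

lemma YD_mod: "X \<in> obj Db \<Longrightarrow> YD X \<in> obj (mod_cat D)"
  using Db.hom_functor_mod[OF inj] unfolding controlled_cat_def by blast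

definition P :: "((('a, 'u) controlled, ('a \<Rightarrow> 'r) \<Rightarrow> ('a \<Rightarrow> 'r), 'g) cat_module,
        ('a, 'u) controlled \<Rightarrow> 'g \<Rightarrow> 'g,
        (('a, 't) controlled, ('a \<Rightarrow> 'r) \<Rightarrow> ('a \<Rightarrow> 'r), 'g) cat_module,
        ('a, 't) controlled \<Rightarrow> 'g \<Rightarrow> 'g) functor_data" where
  "P = precomposition C (change_of_tree f)"

lemma P_simps:
  "fob (fob P N) Z = fob N (F Z)" "fmor (fob P N) Z Z' g = fmor N (F Z) (F Z') g"
  "fmor P N N' \<tau> = (\<lambda>Z \<in> obj C. \<tau> (F Z))"
  by (simp_all add: P_def precomposition_def functor_comp_def op_functor_def)

text \<open>
  At \<open>Z\<close> this is the map \<open>Hom(Z, X) \<rightarrow> Hom(F Z, F X)\<close> that \<open>F\<close> induces, between the copies of the two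
  groups with elements in \<open>'g\<close>.
\<close>

definition comparison :: "('a, 't) controlled \<Rightarrow> ('a, 't) controlled \<Rightarrow> 'g \<Rightarrow> 'g" where
  "comparison X = (\<lambda>Z \<in> obj C. \<lambda>u \<in> j ` arr Cb Z X. u)"

lemma comparison_apply: "Z \<in> obj C \<Longrightarrow> \<phi> \<in> arr Cb Z X \<Longrightarrow> comparison X Z (j \<phi>) = j \<phi>"
  by (simp add: comparison_def)

lemmas YC_simps = hom_functor_simps[OF inj, where C = Cb]
lemmas YD_simps = hom_functor_simps[OF inj, where C = Db]

lemma comparison_arr:
  assumes X: "X \<in> obj Cb" and P: "fob P (YD (F X)) \<in> obj (mod_cat C)"
  shows "comparison X \<in> arr (mod_cat C) (YC X) (fob P (YD (F X)))"
proof (rule mod_cat_arrI[OF YC_mod[OF X] P])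
  show "comparison X \<in> extensional (obj C)" by (simp add: comparison_def)
  fix Z assume Z: "Z \<in> obj C"
  then have Zb: "Z \<in> obj Cb" by (rule controlled_cat_obj_big)
  show "comparison X Z \<in> hom (fob (YC X) Z) (fob (fob P (YD (F X))) Z) \<inter> extensional (carrier (fob (YC X) Z))"
  proof
    show "comparison X Z \<in> hom (fob (YC X) Z) (fob (fob P (YD (F X))) Z)"
    proof (rule homI)
      fix x y assume "x \<in> carrier (fob (YC X) Z)" "y \<in> carrier (fob (YC X) Z)"
      then obtain \<phi> \<psi> where \<phi>: "x = j \<phi>" "\<phi> \<in> arr Cb Z X" "y = j \<psi>" "\<psi> \<in> arr Cb Z X"
        by (auto simp: YC_simps)
      then show "comparison X Z (x \<otimes>\<^bsub>fob (YC X) Z\<^esub> y) = comparison X Z x \<otimes>\<^bsub>fob (fob P (YD (F X))) Z\<^esub> comparison X Z y"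
        using F_arr[OF Zb \<phi>(2)] F_arr[OF Zb \<phi>(4)] controlled_add[OF \<phi>(2,4)]
        by (simp add: comparison_apply[OF Z] YC_simps YD_simps P_simps) (simp add: big_controlled_cat_simps(5))
    qed (auto simp: comparison_apply[OF Z] YC_simps YD_simps P_simps intro: F_arr[OF Zb])
    show "comparison X Z \<in> extensional (carrier (fob (YC X) Z))"
      using Z by (simp add: comparison_def YC_simps)
  qed
  fix Z' g x assume Z': "Z' \<in> obj C" and g: "g \<in> arr C Z' Z" and "x \<in> carrier (fob (YC X) Z)"
  then obtain \<phi> where \<phi>: "x = j \<phi>" "\<phi> \<in> arr Cb Z X"
    by (auto simp: YC_simps)
  have g: "g \<in> arr Cb Z' Z" using g by (simp add: controlled_cat_simps)
  have c: "cmp Cb Z' Z X \<phi> g \<in> arr Cb Z' X"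
    using Cb.comp_arr[OF controlled_cat_obj_big[OF Z'] Zb X g \<phi>(2)] .
  show "comparison X Z' (fmor (YC X) Z Z' g x) = fmor (fob P (YD (F X))) Z Z' g (comparison X Z x)"
    using c F_arr[OF Zb \<phi>(2)]
    by (simp add: \<phi> comparison_apply[OF Z] comparison_apply[OF Z'] YC_simps YD_simps P_simps)
      (simp add: big_controlled_cat_simps(4))
qed

lemma comparison_natural:
  assumes X: "X \<in> obj Cb" and X': "X' \<in> obj Cb" and h: "h \<in> arr Cb X X'"
  shows "cmp (mod_cat C) (YC X) (YC X') (fob P (YD (F X'))) (comparison X') (fmor (restricted_yoneda j Cb C) X X' h)
    = cmp (mod_cat C) (YC X) (fob P (YD (F X))) (fob P (YD (F X')))
        (fmor P (YD (F X)) (YD (F X')) (fmor (restricted_yoneda j Db D) (F X) (F X') h)) (comparison X)"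
  unfolding mod_cat_simps
proof (rule restrict_ext, unfold compose_def, rule restrict_ext)
  fix Z x assume Z: "Z \<in> obj C" and "x \<in> carrier (fob (YC X) Z)"
  then obtain \<phi> where \<phi>: "x = j \<phi>" "\<phi> \<in> arr Cb Z X"
    by (auto simp: YC_simps)
  have Zb: "Z \<in> obj Cb" using Z by (rule controlled_cat_obj_big)
  have FZ: "F Z \<in> obj D" using F_obj_iff[OF Zb] Z by simp
  note ry = restricted_yoneda_simps(2)[OF inj, where C = Cb, OF Z]
    restricted_yoneda_simps(2)[OF inj, where C = Db, OF FZ]
  show "comparison X' Z (fmor (restricted_yoneda j Cb C) X X' h Z x) =
    fmor P (YD (F X)) (YD (F X')) (fmor (restricted_yoneda j Db D) (F X) (F X') h) Z (comparison X Z x)"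
    using Cb.comp_arr[OF Zb X X' \<phi>(2) h] F_arr[OF Zb \<phi>(2)] Z \<phi>(2)
    by (simp add: \<phi>(1) P_simps ry comparison_apply) (simp add: big_controlled_cat_simps(4))
qed

text \<open>
  The Yoneda lemma for a directed union of representables. Let \<open>Proper\<close> consist of the \<open>B\<close>
  whose subobjects are non-big. A morphism \<open>\<phi>\<close> from a non-big module over \<open>T'\<close> factors through
  some \<open>B \<in> Proper\<close>, and naturality forces the extension of \<open>\<theta>\<close> to send \<open>\<phi>\<close> to \<open>N(\<phi>) (e B)\<close>, where \<open>e B\<close> is the value
  of \<open>\<theta>\<close> at the inclusion of \<open>B\<close>. This gives uniqueness. The same formula defines an extension because it is independent of \<open>B\<close>
  (\<open>ev_mono\<close>); in particular two morphisms can be compared inside one subobject, which gives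
  additivity.
\<close>

lemma comparison_universal:
  assumes X: "X \<in> obj Cb" and N: "N \<in> obj (mod_cat D)"
    and \<theta>: "\<theta> \<in> arr (mod_cat C) (YC X) (fob P N)"
  shows "\<exists>!\<tau>. \<tau> \<in> arr (mod_cat D) (YD (F X)) N \<and>
    cmp (mod_cat C) (YC X) (fob P (YD (F X))) (fob P N) (fmor P (YD (F X)) N \<tau>) (comparison X) = \<theta>"
proof -
  note Nd = mod_cat_objD[OF N, unfolded controlled_cat_simps]
    and \<theta>d = mod_cat_arrD[OF \<theta>, unfolded controlled_cat_simps P_simps]
  note FX = F_obj[OF X]
  have restr: "cmp (mod_cat C) (YC X) (fob P (YD (F X))) (fob P N) (fmor P (YD (F X)) N \<tau>) (comparison X)
      = (\<lambda>Z \<in> obj C. \<lambda>u \<in> j ` arr Cb Z X. \<tau> (F Z) u)" for \<tau>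
    unfolding mod_cat_simps
    by (rule restrict_ext) (auto simp: compose_def P_simps YC_simps comparison_apply intro!: restrict_ext)
  \<comment> \<open>By restriction to \<open>T\<close>, any extension must take this value at the inclusion of \<open>B\<close>.\<close>
  define e where "e = (\<lambda>B. \<theta> (subobject X B) (j (ident Cb (subobject X B))))"
  define Proper where "Proper = {B. B \<subseteq> fst X \<and> subobject X B \<in> obj C}"
  have Proper_obj: "subobject X B \<in> obj C" "F (subobject X B) \<in> obj D" "B \<subseteq> fst X"
    "F (subobject X B) = subobject (F X) B" if "B \<in> Proper" for B
    using that F_obj_iff[of "subobject X B"] controlled_cat_obj_big[of "subobject X B" T] F_subobject[of B X]
    by (auto simp: Proper_def)
  have incl: "ident Cb (subobject X B) \<in> arr Cb (subobject X B) X" if "B \<in> Proper" for B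
    using inclusion_arr(2)[of B B X] Proper_obj(3)[OF that] by simp
  have e_closed: "e B \<in> carrier (fob N (F (subobject X B)))" if B: "B \<in> Proper" for B
    unfolding e_def using hom_in_carrier[OF \<theta>d(2)[OF Proper_obj(1)[OF B]]] incl[OF B]
    by (simp add: YC_simps)
  have arr_sub: "\<phi> \<in> arr Db Z (F (subobject X B))"
    if "B \<in> Proper" "\<phi> \<in> arr Db Z (F X)" "hom_support R Z \<phi> \<subseteq> B" for B \<phi> Z
    using that arr_subobject_iff[of B "F X" \<phi> T' Z] Proper_obj(3,4)[OF that(1)] by simp
  have sup_Proper: "hom_support R Z \<phi> \<in> Proper" if "Z \<in> obj D" "\<phi> \<in> arr Db Z (F X)" for Z \<phi>
  proof -
    have sub: "hom_support R Z \<phi> \<subseteq> fst X"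
      using hom_support_subset[OF that(2)] by simp
    then have "F (subobject X (hom_support R Z \<phi>)) \<in> obj D"
      using subobject_hom_support_obj[OF T' that(1) FX that(2)] F_subobject[OF sub] by simp
    then show ?thesis
      using F_obj_iff[OF subobject_obj[OF X sub]] sub by (simp add: Proper_def)
  qed
  have Un_Proper: "B \<union> B' \<in> Proper" if "B \<in> Proper" "B' \<in> Proper" for B B'
    using that subobject_Un_obj[OF T X, of B B'] by (auto simp: Proper_def)
  have e_mono: "e B = fmor N (F (subobject X B')) (F (subobject X B)) (ident Cb (subobject X B)) (e B')"
    if B: "B \<in> Proper" and B': "B' \<in> Proper" and "B \<subseteq> B'" for B B'
  proof -
    let ?i = "ident Cb (subobject X B)"
    have i: "?i \<in> arr Cb (subobject X B) (subobject X B')"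
      by (rule inclusion_arr(1)) (use that Proper_obj(3) in auto)
    have "cmp Cb (subobject X B) (subobject X B') X (ident Cb (subobject X B')) ?i = ?i"
      using \<open>B \<subseteq> B'\<close> free_module_carrier_mono[of B B' R]
      by (auto simp: big_controlled_cat_simps(3,4) compose_def fun_eq_iff)
    then have "fmor (YC X) (subobject X B') (subobject X B) ?i (j (ident Cb (subobject X B'))) = j ?i"
      using YC_simps(3)[OF incl[OF B']] by simp
    then show ?thesis
      unfolding e_def using \<theta>d(4)[OF Proper_obj(1)[OF B'] Proper_obj(1)[OF B] i, of "j (ident Cb (subobject X B'))"]
        incl[OF B'] by (simp add: YC_simps)
  qed
  define ev where "ev = (\<lambda>Z \<phi> B. fmor N (F (subobject X B)) Z \<phi> (e B))"
  have ev_mono: "ev Z \<phi> B = ev Z \<phi> B'"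
    if Z: "Z \<in> obj D" and \<phi>: "\<phi> \<in> arr Db Z (F X)" "hom_support R Z \<phi> \<subseteq> B"
      and B: "B \<in> Proper" "B' \<in> Proper" "B \<subseteq> B'" for Z \<phi> B B'
  proof -
    let ?i = "ident Cb (subobject X B)"
    have i: "?i \<in> arr Db (F (subobject X B)) (F (subobject X B'))"
      using F_arr[OF controlled_cat_obj_big[OF Proper_obj(1)[OF B(1)]]]
        inclusion_arr(1)[OF B(3) Proper_obj(3)[OF B(2)]] .
    have \<phi>B: "\<phi> \<in> arr Db Z (F (subobject X B))"
      by (rule arr_sub[OF B(1) \<phi>])
    have "cmp Db Z (F (subobject X B)) (F (subobject X B')) ?i \<phi>
        = cmp Db Z (F (subobject X B)) (F (subobject X B)) (ident Db (F (subobject X B))) \<phi>"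
      by (simp add: F_ident big_controlled_cat_simps(4))
    also have "\<dots> = \<phi>"
      using Db.comp_ident_left \<phi>B controlled_cat_obj_big Z Proper_obj(2)[OF B(1)] by blast
    finally show ?thesis
      unfolding ev_def e_mono[OF B]
      using Nd(5)[OF Proper_obj(2)[OF B(2)] Proper_obj(2)[OF B(1)] Z i \<phi>B e_closed[OF B(2)]] by simp
  qed
  define extn where "extn = (\<lambda>Z \<in> obj D. \<lambda>u \<in> j ` arr Db Z (F X).
     ev Z (inv_into UNIV j u) (hom_support R Z (inv_into UNIV j u)))"
  have extn: "extn Z (j \<phi>) = ev Z \<phi> B"
    if "Z \<in> obj D" "\<phi> \<in> arr Db Z (F X)" "hom_support R Z \<phi> \<subseteq> B" "B \<in> Proper" for Z \<phi> B
    using that ev_mono[OF that(1,2) subset_refl sup_Proper[OF that(1,2)] that(4,3)]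
    by (simp add: extn_def inv_f_f[OF inj])
  have ext_arr: "extn \<in> arr (mod_cat D) (YD (F X)) N"
  proof (rule mod_cat_arrI[OF YD_mod[OF FX] N])
    show "extn \<in> extensional (obj D)" by (simp add: extn_def)
    fix Z assume Z: "Z \<in> obj D"
    show "extn Z \<in> hom (fob (YD (F X)) Z) (fob N Z) \<inter> extensional (carrier (fob (YD (F X)) Z))"
    proof
      show "extn Z \<in> extensional (carrier (fob (YD (F X)) Z))"
        using Z by (simp add: extn_def YD_simps)
      show "extn Z \<in> hom (fob (YD (F X)) Z) (fob N Z)"
      proof (rule homI)
        fix x assume "x \<in> carrier (fob (YD (F X)) Z)"
        then obtain \<phi> where \<phi>: "x = j \<phi>" "\<phi> \<in> arr Db Z (F X)"
          by (auto simp: YD_simps)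
        let ?B = "hom_support R Z \<phi>"
        have B: "?B \<in> Proper" using sup_Proper[OF Z \<phi>(2)] .
        show "extn Z x \<in> carrier (fob N Z)"
          using hom_in_carrier[OF Nd(2)[OF Proper_obj(2)[OF B] Z arr_sub[OF B \<phi>(2) subset_refl]] e_closed[OF B]]
          by (simp add: \<phi>(1) extn[OF Z \<phi>(2) subset_refl B] ev_def)
        fix y assume "y \<in> carrier (fob (YD (F X)) Z)"
        then obtain \<psi> where \<psi>: "y = j \<psi>" "\<psi> \<in> arr Db Z (F X)"
          by (auto simp: YD_simps)
        let ?B = "hom_support R Z \<phi> \<union> hom_support R Z \<psi>"
        have B: "?B \<in> Proper" using Un_Proper sup_Proper[OF Z] \<phi>(2) \<psi>(2) by blast
        have hadd_sub: "hadd Db Z (F X) \<phi> \<psi> = hadd Db Z (F (subobject X ?B)) \<phi> \<psi>"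
          by (simp add: big_controlled_cat_simps(5))
        have "extn Z (j (hadd Db Z (F X) \<phi> \<psi>)) = ev Z (hadd Db Z (F X) \<phi> \<psi>) ?B"
          by (rule extn[OF Z controlled_add[OF \<phi>(2) \<psi>(2)] hom_support_add[OF \<phi>(2) \<psi>(2)] B])
        also have "\<dots> = ev Z \<phi> ?B \<otimes>\<^bsub>fob N Z\<^esub> ev Z \<psi> ?B"
          unfolding ev_def hadd_sub
          by (rule Nd(6)[OF Proper_obj(2)[OF B] Z arr_sub[OF B \<phi>(2)] arr_sub[OF B \<psi>(2)] e_closed[OF B]]) auto
        also have "ev Z \<phi> ?B = extn Z x"
          using extn[OF Z \<phi>(2) _ B] \<phi>(1) by simp
        also have "ev Z \<psi> ?B = extn Z y"
          using extn[OF Z \<psi>(2) _ B] \<psi>(1) by simp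
        finally show "extn Z (x \<otimes>\<^bsub>fob (YD (F X)) Z\<^esub> y) = extn Z x \<otimes>\<^bsub>fob N Z\<^esub> extn Z y"
          using \<phi> \<psi> by (simp add: YD_simps)
      qed
    qed
    fix Z' g x assume Z': "Z' \<in> obj D" and "g \<in> arr D Z' Z" and "x \<in> carrier (fob (YD (F X)) Z)"
    then obtain \<phi> where g: "g \<in> arr Db Z' Z" and \<phi>: "x = j \<phi>" "\<phi> \<in> arr Db Z (F X)"
      by (auto simp: YD_simps controlled_cat_simps)
    let ?B = "hom_support R Z \<phi>"
    have B: "?B \<in> Proper" using sup_Proper[OF Z \<phi>(2)] .
    have comp_sub: "cmp Db Z' Z (F X) \<phi> g = cmp Db Z' Z (F (subobject X ?B)) \<phi> g"
      by (simp add: big_controlled_cat_simps(4))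
    have "extn Z' (fmor (YD (F X)) Z Z' g x) = extn Z' (j (cmp Db Z' Z (F X) \<phi> g))"
      using \<phi> by (simp add: YD_simps)
    also have "\<dots> = ev Z' (cmp Db Z' Z (F X) \<phi> g) ?B"
      using controlled_comp[OF g \<phi>(2)] hom_support_comp[OF \<phi>(2) g]
      by (intro extn[OF Z' _ _ B]) (simp_all add: big_controlled_cat_simps(4))
    also have "\<dots> = fmor N Z Z' g (ev Z \<phi> ?B)"
      unfolding ev_def comp_sub
      by (rule Nd(5)[OF Proper_obj(2)[OF B] Z Z' arr_sub[OF B \<phi>(2) subset_refl] g e_closed[OF B]])
    also have "ev Z \<phi> ?B = extn Z x"
      using extn[OF Z \<phi>(2) subset_refl B] \<phi>(1) by simp
    finally show "extn Z' (fmor (YD (F X)) Z Z' g x) = fmor N Z Z' g (extn Z x)" .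
  qed
  have ext_restr: "(\<lambda>Z \<in> obj C. \<lambda>u \<in> j ` arr Cb Z X. extn (F Z) u) = \<theta>"
  proof (rule extensionalityI[OF _ \<theta>d(1)])
    fix Z assume Z: "Z \<in> obj C"
    then have Zb: "Z \<in> obj Cb" by (rule controlled_cat_obj_big)
    have FZ: "F Z \<in> obj D" using F_obj_iff[OF Zb] Z by simp
    have "(\<lambda>u \<in> j ` arr Cb Z X. extn (F Z) u) = \<theta> Z"
    proof (rule extensionalityI[OF _ \<theta>d(3)[OF Z, unfolded YC_simps(1)]])
      fix u assume "u \<in> j ` arr Cb Z X"
      then obtain \<phi> where u: "u = j \<phi>" and \<phi>: "\<phi> \<in> arr Cb Z X" by auto
      have F\<phi>: "\<phi> \<in> arr Db (F Z) (F X)" by (rule F_arr[OF Zb \<phi>])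
      let ?B = "hom_support R (F Z) \<phi>"
      have B: "?B \<in> Proper" using sup_Proper[OF FZ F\<phi>] .
      have sup: "?B = hom_support R Z \<phi>" by (simp add: hom_support_def)
      have \<phi>B: "\<phi> \<in> arr Cb Z (subobject X ?B)"
        unfolding sup using arr_subobject_iff[OF hom_support_subset[OF \<phi>]] \<phi> by blast
      have "cmp Cb Z (subobject X ?B) X (ident Cb (subobject X ?B)) \<phi>
          = cmp Cb Z (subobject X ?B) (subobject X ?B) (ident Cb (subobject X ?B)) \<phi>"
        by (simp add: big_controlled_cat_simps(4))
      also have "\<dots> = \<phi>"
        using Cb.comp_ident_left[OF Zb _ \<phi>B] Proper_obj(1)[OF B] controlled_cat_obj_big by blast
      finally have "\<theta> Z (j \<phi>) = fmor N (F (subobject X ?B)) (F Z) \<phi> (e ?B)"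
        unfolding e_def using \<theta>d(4)[OF Proper_obj(1)[OF B] Z \<phi>B, of "j (ident Cb (subobject X ?B))"] incl[OF B]
        by (simp add: YC_simps)
      then show "(\<lambda>u \<in> j ` arr Cb Z X. extn (F Z) u) u = \<theta> Z u"
        using \<phi> u extn[OF FZ F\<phi> subset_refl B] by (simp add: ev_def)
    qed simp
    then show "(\<lambda>Z \<in> obj C. \<lambda>u \<in> j ` arr Cb Z X. extn (F Z) u) Z = \<theta> Z"
      using Z by simp
  qed simp
  have unique: "\<tau> = extn" if \<tau>: "\<tau> \<in> arr (mod_cat D) (YD (F X)) N"
    and \<tau>\<theta>: "(\<lambda>Z \<in> obj C. \<lambda>u \<in> j ` arr Cb Z X. \<tau> (F Z) u) = \<theta>" for \<tau>
  proof (rule extensionalityI[OF mod_cat_arrD(1)[OF \<tau>] mod_cat_arrD(1)[OF ext_arr]])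
    fix Z assume Z: "Z \<in> obj D"
    show "\<tau> Z = extn Z"
    proof (rule extensionalityI[OF mod_cat_arrD(3)[OF \<tau> Z] mod_cat_arrD(3)[OF ext_arr Z]])
      fix u assume "u \<in> carrier (fob (YD (F X)) Z)"
      then obtain \<phi> where u: "u = j \<phi>" and \<phi>: "\<phi> \<in> arr Db Z (F X)" by (auto simp: YD_simps)
      let ?B = "hom_support R Z \<phi>" and ?i = "\<lambda>B. ident Cb (subobject X B)"
      have B: "?B \<in> Proper" using sup_Proper[OF Z \<phi>] .
      have \<phi>B: "\<phi> \<in> arr Db Z (F (subobject X ?B))" by (rule arr_sub[OF B \<phi> subset_refl])
      have i: "?i ?B \<in> arr Db (F (subobject X ?B)) (F X)"
        by (rule F_arr[OF _ incl[OF B]]) (use Proper_obj(1)[OF B] controlled_cat_obj_big in blast)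
      have "cmp Db Z (F (subobject X ?B)) (F X) (?i ?B) \<phi>
          = cmp Db Z (F (subobject X ?B)) (F (subobject X ?B)) (ident Db (F (subobject X ?B))) \<phi>"
        by (simp add: big_controlled_cat_simps(4) F_ident)
      also have "\<dots> = \<phi>"
        using Db.comp_ident_left[OF _ _ \<phi>B] Proper_obj(2)[OF B] Z controlled_cat_obj_big by blast
      finally have "j \<phi> = fmor (YD (F X)) (F (subobject X ?B)) Z \<phi> (j (?i ?B))"
        using YD_simps(3)[OF i] by simp
      then have "\<tau> Z (j \<phi>) = fmor N (F (subobject X ?B)) Z \<phi> (\<tau> (F (subobject X ?B)) (j (?i ?B)))"
        using mod_cat_arrD(4)[OF \<tau> Proper_obj(2)[OF B] Z, of \<phi> "j (?i ?B)"] \<phi>B i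
        by (simp add: YD_simps controlled_cat_simps)
      also have "\<tau> (F (subobject X ?B)) (j (?i ?B)) = e ?B"
        unfolding e_def \<tau>\<theta>[symmetric] using Proper_obj(1)[OF B] incl[OF B] by simp
      finally show "\<tau> Z u = extn Z u"
        using u extn[OF Z \<phi> subset_refl B] by (simp add: ev_def)
    qed
  qed
  show ?thesis
    unfolding restr using ext_arr ext_restr unique by blast
qed

end

theorem proposition1p2p12:
  fixes R :: "('r, 'x) ring_scheme"
    and T :: "'t topology" and T' :: "'u topology" and f :: "'t \<Rightarrow> 'u"
    and j :: "(('a \<Rightarrow> 'r) \<Rightarrow> ('a \<Rightarrow> 'r)) \<Rightarrow> 'g"
    and F_star :: "((('a, 't) controlled, ('a \<Rightarrow> 'r) \<Rightarrow> ('a \<Rightarrow> 'r), 'g) cat_module,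
        ('a, 't) controlled \<Rightarrow> 'g \<Rightarrow> 'g,
        (('a, 'u) controlled, ('a \<Rightarrow> 'r) \<Rightarrow> ('a \<Rightarrow> 'r), 'g) cat_module,
        ('a, 'u) controlled \<Rightarrow> 'g \<Rightarrow> 'g) functor_data"
  assumes "cring R"
    and "is_tree T" and "is_tree T'"
    and "continuous_map T T' f" and "proper_map T T' f"
    and "inj j"
    and "is_left_adjoint (mod_cat (controlled_cat R T)) (mod_cat (controlled_cat R T')) F_star
           (precomposition (controlled_cat R T) (change_of_tree f))"
  shows "naturally_isomorphic (big_controlled_cat R T) (mod_cat (controlled_cat R T'))
           (functor_comp
             (restricted_yoneda j (big_controlled_cat R T') (controlled_cat R T'))
             (change_of_tree f))
           (functor_comp
             F_star
             (restricted_yoneda j (big_controlled_cat R T) (controlled_cat R T)))"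
proof -
  interpret tree_change R T T' f j
    using assms(1-6) by (intro tree_change.intro tree_change_axioms.intro) (simp_all add: cring.axioms(1))
  have adj: "is_left_adjoint (mod_cat C) (mod_cat D) F_star P"
    using assms(7) by (simp add: P_def)
  have P: "is_functor (mod_cat D) (mod_cat C) P"
    using adj by (simp add: is_left_adjoint_def)
  have YC: "is_functor Cb (mod_cat C) (restricted_yoneda j Cb C)"
    using Cb.is_functor_restricted_yoneda[OF inj] is_functorD(2)[OF P] unfolding controlled_cat_def by blast
  have YD: "is_functor Db (mod_cat D) (restricted_yoneda j Db D)"
    using Db.is_functor_restricted_yoneda[OF inj] is_functorD(1)[OF P] unfolding controlled_cat_def by blast
  have fobY: "fob (restricted_yoneda j Cb C) X = YC X" for X
    by (simp add: restricted_yoneda_simps(1)[OF inj])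
  have fobG: "fob (functor_comp (restricted_yoneda j Db D) (change_of_tree f)) X = YD (F X)" for X
    by (simp add: restricted_yoneda_simps(1)[OF inj] functor_comp_def)
  have fmorG: "fmor (functor_comp (restricted_yoneda j Db D) (change_of_tree f)) X X' h
      = fmor (restricted_yoneda j Db D) (F X) (F X') h" for X X' h
    by (simp add: functor_comp_def)
  show ?thesis
  proof (rule left_adjoint_naturally_isomorphic[OF adj YC is_functor_functor_comp[OF is_functor_change_of_tree YD],
        where \<eta> = comparison]; unfold fobY fobG fmorG)
    show "comparison X \<in> arr (mod_cat C) (YC X) (fob P (YD (F X)))" if "X \<in> obj Cb" for X
      using comparison_arr[OF that] is_functorD(3)[OF P YD_mod[OF F_obj[OF that]]] .
  qed (rule comparison_natural comparison_universal; assumption)+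
qed

end
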